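(* Let $A$ be an infinitesimal bialgebra over a field $\Bbbk$, and consider the space $\mathrm{End}(A)$ of linear endomorphisms of $A$ as an associative algebra under composition. Then the maps $\beta,\gamma:\mathrm{End}(A)\to\mathrm{End}(A)$ defined by $$\beta(T)=\mathrm{id}\ast T\qquad\text{and}\qquad\gamma(T)=T\ast\mathrm{id},$$ where $\ast$ denotes convolution of endomorphisms, are a pair of commuting Baxter operators on $\mathrm{End}(A)$; that is, $\beta$ and $\gamma$ are Baxter operators and $\beta\gamma=\gamma\beta$.
   Context: An infinitesimal bialgebra is a triple $(A,\mu,\Delta)$ where $(A,\mu)$ is an associative algebra, $(A,\Delta)$ is a coassociative coalgebra (no unit or counit is required), and for all $a,b\in A$, $\Delta(ab)=ab_1\otimes b_2+a_1\otimes a_2b$, where $\Delta(a)=a_1\otimes a_2$ is Sweedler notation (with summation suppressed). The product on $\mathrm{End}(A)$ is composition: $TS$ means $S$ followed by $T$. The convolution of $T,S\in\mathrm{End}(A)$ is $T\ast S:=\mu\circ(T\otimes S)\circ\Delta$. A Baxter operator on an associative algebra $(B,\cdot)$ is a linear map $\beta:B\to B$ such that $\beta(x)\cdot\beta(y)=\beta\bigl(x\cdot\beta(y)+\beta(x)\cdot y\bigr)$ for all $x,y\in B$. *)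

theory Defs
  imports "HOL-Algebra.Module" "HOL-Algebra.AbelCoset"
begin

text \<open>
  Vector spaces over a field \<open>K\<close> are modules over \<open>K\<close> in the sense of HOL-Algebra.  The
  module record also has the fields \<open>mult\<close> and \<open>one\<close>, about which the locale \<open>module\<close> says nothing;
  they are left undefined where they have no meaning.
\<close>

section \<open>Linear maps\<close>

text \<open>
  Linear maps are extensional (\<open>undefined\<close> off the carrier of the domain), so that HOL equality
  of linear maps is equality of maps on the carrier.
\<close>

definition linear_maps ::
  "('k, 'r) ring_scheme \<Rightarrow> ('k, 'a, 'm) module_scheme \<Rightarrow> ('k, 'b, 'n) module_scheme \<Rightarrow> ('a \<Rightarrow> 'b) set"
  where "linear_maps K M N =
    {f \<in> carrier M \<rightarrow>\<^sub>E carrier N.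
       (\<forall>x\<in>carrier M. \<forall>y\<in>carrier M. f (x \<oplus>\<^bsub>M\<^esub> y) = f x \<oplus>\<^bsub>N\<^esub> f y) \<and>
       (\<forall>c\<in>carrier K. \<forall>x\<in>carrier M. f (c \<odot>\<^bsub>M\<^esub> x) = c \<odot>\<^bsub>N\<^esub> f x)}"

section \<open>Tensor products\<close>

definition free_module :: "('k, 'r) ring_scheme \<Rightarrow> 'x set \<Rightarrow> ('k, 'x \<Rightarrow> 'k) module"
  where "free_module K X =
    \<lparr>carrier = {u. (\<forall>p\<in>X. u p \<in> carrier K) \<and> (\<forall>p. p \<notin> X \<longrightarrow> u p = \<zero>\<^bsub>K\<^esub>) \<and> finite {p. u p \<noteq> \<zero>\<^bsub>K\<^esub>}},
     mult = undefined, one = undefined,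
     zero = (\<lambda>p. \<zero>\<^bsub>K\<^esub>), add = (\<lambda>u v p. u p \<oplus>\<^bsub>K\<^esub> v p),
     smult = (\<lambda>c u p. c \<otimes>\<^bsub>K\<^esub> u p)\<rparr>"

definition free_gen :: "('k, 'r) ring_scheme \<Rightarrow> 'x \<Rightarrow> 'x \<Rightarrow> 'k"
  where "free_gen K x = (\<lambda>p. if p = x then \<one>\<^bsub>K\<^esub> else \<zero>\<^bsub>K\<^esub>)"

definition submodule_span :: "('k, 'r) ring_scheme \<Rightarrow> ('k, 'a, 'm) module_scheme \<Rightarrow> 'a set \<Rightarrow> 'a set"
  where "submodule_span K M S = \<Inter>{H. submodule H K M \<and> S \<subseteq> H}"

text \<open>
  Adding \<open>H\<close> in the scalar multiplication only matters for the scalar zero, where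
  \<open>(\<lambda>x. c \<odot> x) ` X\<close> is \<open>{\<zero>}\<close> rather than the coset \<open>H\<close>.
\<close>

definition quotient_module :: "('k, 'a, 'm) module_scheme \<Rightarrow> 'a set \<Rightarrow> ('k, 'a set) module"
  where "quotient_module M H =
    \<lparr>carrier = a_rcosets\<^bsub>M\<^esub> H,
     mult = undefined, one = undefined,
     zero = H, add = (\<lambda>X Y. X <+>\<^bsub>M\<^esub> Y),
     smult = (\<lambda>c X. H <+>\<^bsub>M\<^esub> (\<lambda>x. c \<odot>\<^bsub>M\<^esub> x) ` X)\<rparr>"

definition tensor_relations ::
  "('k, 'r) ring_scheme \<Rightarrow> ('k, 'a, 'm) module_scheme \<Rightarrow> ('k, 'b, 'n) module_scheme
    \<Rightarrow> ('a \<times> 'b \<Rightarrow> 'k) set"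
  where "tensor_relations K M N = (let F = free_module K (carrier M \<times> carrier N); \<delta> = free_gen K in
    {\<delta> (x \<oplus>\<^bsub>M\<^esub> x', y) \<ominus>\<^bsub>F\<^esub> (\<delta> (x, y) \<oplus>\<^bsub>F\<^esub> \<delta> (x', y)) | x x' y.
       x \<in> carrier M \<and> x' \<in> carrier M \<and> y \<in> carrier N} \<union>
    {\<delta> (x, y \<oplus>\<^bsub>N\<^esub> y') \<ominus>\<^bsub>F\<^esub> (\<delta> (x, y) \<oplus>\<^bsub>F\<^esub> \<delta> (x, y')) | x y y'.
       x \<in> carrier M \<and> y \<in> carrier N \<and> y' \<in> carrier N} \<union>
    {\<delta> (c \<odot>\<^bsub>M\<^esub> x, y) \<ominus>\<^bsub>F\<^esub> c \<odot>\<^bsub>F\<^esub> \<delta> (x, y) | c x y.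
       c \<in> carrier K \<and> x \<in> carrier M \<and> y \<in> carrier N} \<union>
    {\<delta> (x, c \<odot>\<^bsub>N\<^esub> y) \<ominus>\<^bsub>F\<^esub> c \<odot>\<^bsub>F\<^esub> \<delta> (x, y) | c x y.
       c \<in> carrier K \<and> x \<in> carrier M \<and> y \<in> carrier N})"

definition tensor_kernel ::
  "('k, 'r) ring_scheme \<Rightarrow> ('k, 'a, 'm) module_scheme \<Rightarrow> ('k, 'b, 'n) module_scheme
    \<Rightarrow> ('a \<times> 'b \<Rightarrow> 'k) set"
  where "tensor_kernel K M N =
    submodule_span K (free_module K (carrier M \<times> carrier N)) (tensor_relations K M N)"

definition tensor ::
  "('k, 'r) ring_scheme \<Rightarrow> ('k, 'a, 'm) module_scheme \<Rightarrow> ('k, 'b, 'n) module_scheme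
    \<Rightarrow> ('k, ('a \<times> 'b \<Rightarrow> 'k) set) module"
  where "tensor K M N =
    quotient_module (free_module K (carrier M \<times> carrier N)) (tensor_kernel K M N)"

definition pure_tensor ::
  "('k, 'r) ring_scheme \<Rightarrow> ('k, 'a, 'm) module_scheme \<Rightarrow> ('k, 'b, 'n) module_scheme
    \<Rightarrow> 'a \<Rightarrow> 'b \<Rightarrow> ('a \<times> 'b \<Rightarrow> 'k) set"
  where "pure_tensor K M N x y =
    tensor_kernel K M N +>\<^bsub>free_module K (carrier M \<times> carrier N)\<^esub> free_gen K (x, y)"

text \<open>
  The linear map \<open>M \<otimes> N \<rightarrow> P\<close> induced by a bilinear map \<open>f\<close>; it is only meaningful for bilinear \<open>f\<close>,
  for which it exists and is unique by the universal property of the tensor product.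
\<close>

definition tensor_lift ::
  "('k, 'r) ring_scheme \<Rightarrow> ('k, 'a, 'm) module_scheme \<Rightarrow> ('k, 'b, 'n) module_scheme
    \<Rightarrow> ('k, 'c, 'p) module_scheme \<Rightarrow> ('a \<Rightarrow> 'b \<Rightarrow> 'c) \<Rightarrow> ('a \<times> 'b \<Rightarrow> 'k) set \<Rightarrow> 'c"
  where "tensor_lift K M N P f =
    (THE F. F \<in> linear_maps K (tensor K M N) P \<and>
       (\<forall>x\<in>carrier M. \<forall>y\<in>carrier N. F (pure_tensor K M N x y) = f x y))"

definition tensor_map ::
  "('k, 'r) ring_scheme \<Rightarrow> ('k, 'a, 'm) module_scheme \<Rightarrow> ('k, 'b, 'n) module_scheme
    \<Rightarrow> ('k, 'c, 'p) module_scheme \<Rightarrow> ('k, 'd, 'q) module_scheme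
    \<Rightarrow> ('a \<Rightarrow> 'c) \<Rightarrow> ('b \<Rightarrow> 'd) \<Rightarrow> ('a \<times> 'b \<Rightarrow> 'k) set \<Rightarrow> ('c \<times> 'd \<Rightarrow> 'k) set"
  where "tensor_map K M N P Q f g =
    tensor_lift K M N (tensor K P Q) (\<lambda>x y. pure_tensor K P Q (f x) (g y))"

text \<open>The canonical map \<open>(M \<otimes> N) \<otimes> P \<rightarrow> M \<otimes> (N \<otimes> P)\<close>.\<close>

definition tensor_assoc ::
  "('k, 'r) ring_scheme \<Rightarrow> ('k, 'a, 'm) module_scheme \<Rightarrow> ('k, 'b, 'n) module_scheme
    \<Rightarrow> ('k, 'c, 'p) module_scheme
    \<Rightarrow> (('a \<times> 'b \<Rightarrow> 'k) set \<times> 'c \<Rightarrow> 'k) set \<Rightarrow> ('a \<times> ('b \<times> 'c \<Rightarrow> 'k) set \<Rightarrow> 'k) set"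
  where "tensor_assoc K M N P =
    tensor_lift K (tensor K M N) P (tensor K M (tensor K N P))
      (\<lambda>t z. tensor_lift K M N (tensor K M (tensor K N P))
        (\<lambda>x y. pure_tensor K M (tensor K N P) x (pure_tensor K N P y z)) t)"

section \<open>Algebras, coalgebras and infinitesimal bialgebras\<close>

text \<open>
  Algebras need not be commutative or unital: the field \<open>one\<close> of the record is unconstrained.
  The locale \<open>algebra\<close> of HOL-Algebra requires both.
\<close>

locale associative_algebra = field K + module K A for K (structure) and A (structure) +
  assumes mult_closed: "\<lbrakk>x \<in> carrier A; y \<in> carrier A\<rbrakk> \<Longrightarrow> x \<otimes>\<^bsub>A\<^esub> y \<in> carrier A"
    and mult_assoc: "\<lbrakk>x \<in> carrier A; y \<in> carrier A; z \<in> carrier A\<rbrakk>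
      \<Longrightarrow> (x \<otimes>\<^bsub>A\<^esub> y) \<otimes>\<^bsub>A\<^esub> z = x \<otimes>\<^bsub>A\<^esub> (y \<otimes>\<^bsub>A\<^esub> z)"
    and mult_l_distr: "\<lbrakk>x \<in> carrier A; y \<in> carrier A; z \<in> carrier A\<rbrakk>
      \<Longrightarrow> (x \<oplus>\<^bsub>A\<^esub> y) \<otimes>\<^bsub>A\<^esub> z = x \<otimes>\<^bsub>A\<^esub> z \<oplus>\<^bsub>A\<^esub> y \<otimes>\<^bsub>A\<^esub> z"
    and mult_r_distr: "\<lbrakk>x \<in> carrier A; y \<in> carrier A; z \<in> carrier A\<rbrakk>
      \<Longrightarrow> z \<otimes>\<^bsub>A\<^esub> (x \<oplus>\<^bsub>A\<^esub> y) = z \<otimes>\<^bsub>A\<^esub> x \<oplus>\<^bsub>A\<^esub> z \<otimes>\<^bsub>A\<^esub> y"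
    and smult_mult_l: "\<lbrakk>c \<in> carrier K; x \<in> carrier A; y \<in> carrier A\<rbrakk>
      \<Longrightarrow> (c \<odot>\<^bsub>A\<^esub> x) \<otimes>\<^bsub>A\<^esub> y = c \<odot>\<^bsub>A\<^esub> (x \<otimes>\<^bsub>A\<^esub> y)"
    and smult_mult_r: "\<lbrakk>c \<in> carrier K; x \<in> carrier A; y \<in> carrier A\<rbrakk>
      \<Longrightarrow> x \<otimes>\<^bsub>A\<^esub> (c \<odot>\<^bsub>A\<^esub> y) = c \<odot>\<^bsub>A\<^esub> (x \<otimes>\<^bsub>A\<^esub> y)"

abbreviation id_map :: "('a, 'm) partial_object_scheme \<Rightarrow> 'a \<Rightarrow> 'a"
  where "id_map A \<equiv> (\<lambda>x\<in>carrier A. x)"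

locale coassociative_coalgebra = field K + module K C for K (structure) and C (structure) +
  fixes \<Delta> :: "'c \<Rightarrow> ('c \<times> 'c \<Rightarrow> 'a) set"
  assumes comult_linear: "\<Delta> \<in> linear_maps K C (tensor K C C)"
    and coassoc: "x \<in> carrier C \<Longrightarrow>
      tensor_assoc K C C C (tensor_map K C C (tensor K C C) C \<Delta> (id_map C) (\<Delta> x)) =
      tensor_map K C C C (tensor K C C) (id_map C) \<Delta> (\<Delta> x)"

text \<open>
  In Sweedler notation, \<open>a b\<^sub>1 \<otimes> b\<^sub>2\<close> is the image of \<open>\<Delta> b\<close> under \<open>(x \<mapsto> a x) \<otimes> id\<close> and
  \<open>a\<^sub>1 \<otimes> a\<^sub>2 b\<close> is the image of \<open>\<Delta> a\<close> under \<open>id \<otimes> (y \<mapsto> y b)\<close>.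
\<close>

locale infinitesimal_bialgebra =
  associative_algebra K A + coassociative_coalgebra K A \<Delta>
  for K (structure) and A (structure) and \<Delta> +
  assumes comult_mult: "\<lbrakk>a \<in> carrier A; b \<in> carrier A\<rbrakk> \<Longrightarrow>
      \<Delta> (a \<otimes>\<^bsub>A\<^esub> b) =
        tensor_map K A A A A (\<lambda>x\<in>carrier A. a \<otimes>\<^bsub>A\<^esub> x) (id_map A) (\<Delta> b)
        \<oplus>\<^bsub>tensor K A A\<^esub>
        tensor_map K A A A A (id_map A) (\<lambda>y\<in>carrier A. y \<otimes>\<^bsub>A\<^esub> b) (\<Delta> a)"

section \<open>Endomorphisms, convolution and Baxter operators\<close>

definition End_algebra ::
  "('k, 'r) ring_scheme \<Rightarrow> ('k, 'a, 'm) module_scheme \<Rightarrow> ('k, 'a \<Rightarrow> 'a) module"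
  where "End_algebra K A =
    \<lparr>carrier = linear_maps K A A,
     mult = (\<lambda>T S. compose (carrier A) T S), one = id_map A,
     zero = (\<lambda>x\<in>carrier A. \<zero>\<^bsub>A\<^esub>), add = (\<lambda>T S. \<lambda>x\<in>carrier A. T x \<oplus>\<^bsub>A\<^esub> S x),
     smult = (\<lambda>c T. \<lambda>x\<in>carrier A. c \<odot>\<^bsub>A\<^esub> T x)\<rparr>"

definition mult_map ::
  "('k, 'r) ring_scheme \<Rightarrow> ('k, 'a, 'm) module_scheme \<Rightarrow> ('a \<times> 'a \<Rightarrow> 'k) set \<Rightarrow> 'a"
  where "mult_map K A = tensor_lift K A A A (\<lambda>x y. x \<otimes>\<^bsub>A\<^esub> y)"

definition convolution ::
  "('k, 'r) ring_scheme \<Rightarrow> ('k, 'a, 'm) module_scheme \<Rightarrow> ('a \<Rightarrow> ('a \<times> 'a \<Rightarrow> 'k) set)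
    \<Rightarrow> ('a \<Rightarrow> 'a) \<Rightarrow> ('a \<Rightarrow> 'a) \<Rightarrow> 'a \<Rightarrow> 'a"
  where "convolution K A \<Delta> T S = (\<lambda>x\<in>carrier A. mult_map K A (tensor_map K A A A A T S (\<Delta> x)))"

locale baxter_operator = associative_algebra K B for K (structure) and B (structure) +
  fixes \<beta> :: "'c \<Rightarrow> 'c"
  assumes baxter_linear: "\<beta> \<in> linear_maps K B B"
    and baxter: "\<lbrakk>x \<in> carrier B; y \<in> carrier B\<rbrakk> \<Longrightarrow>
      \<beta> x \<otimes>\<^bsub>B\<^esub> \<beta> y = \<beta> (x \<otimes>\<^bsub>B\<^esub> \<beta> y \<oplus>\<^bsub>B\<^esub> \<beta> x \<otimes>\<^bsub>B\<^esub> y)"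

end

theory Submission
  imports Defs
begin

text \<open>
  The universal property of \<open>A \<otimes> A\<close> turns a bilinear map \<open>f\<close> into a linear map
  \<open>a \<mapsto> f a\<^sub>1 a\<^sub>2\<close>, for which coassociativity and the compatibility of \<open>\<Delta>\<close> with products become
  identities between elements of \<open>A\<close>.  As \<open>\<beta> S a = a\<^sub>1 S(a\<^sub>2)\<close>, that compatibility gives
  \<open>\<beta> T (\<beta> S a) = \<beta> T (a\<^sub>1 S(a\<^sub>2)) = a\<^sub>1 S(a\<^sub>2)\<^sub>1 T(S(a\<^sub>2)\<^sub>2) + a\<^sub>1 T(a\<^sub>2 S(a\<^sub>3))\<close>, which is
  \<open>a\<^sub>1 (\<beta> T)(S(a\<^sub>2)) + a\<^sub>1 T(\<beta> S a\<^sub>2)\<close>, the Baxter identity.  The computation for \<open>\<gamma>\<close> is the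
  mirror image, and both \<open>\<beta> (\<gamma> T) a\<close> and \<open>\<gamma> (\<beta> T) a\<close> are \<open>a\<^sub>1 T(a\<^sub>2) a\<^sub>3\<close>.
\<close>

section \<open>Linear maps\<close>

text \<open>The obstacle is that convolution, \<open>tensor_map\<close> and
  \<open>tensor_assoc\<close> all rest on \<open>tensor_lift\<close>, a definite description that
  says nothing until a lift is known to exist and to be unique. Hence the tensor product is
  developed from its construction as a quotient of a free module, and each Sweedler manipulation
  carries a bilinearity or trilinearity side condition under which the lift has a known value.
  Threefold tensors are confined to \<open>sw_coassoc\<close>: all sums take values in A, so
  coassociativity is only needed after a linear map into A has been applied to both sides, where it
  equates two nested twofold sums. The two terms of \<Delta>(ab) play different roles. For \<beta>,
  the term that splits the second factor leaves the first outside as a multiplier, whereas the term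
  that splits the first factor splits something that is already a component of \<Delta>(a), and this
  double splitting has to be rebracketed. For \<gamma> the two terms exchange these roles.\<close>

lemma linear_mapsI:
  assumes "\<And>x. x \<in> carrier M \<Longrightarrow> f x \<in> carrier N"
    and "\<And>x y. \<lbrakk>x \<in> carrier M; y \<in> carrier M\<rbrakk> \<Longrightarrow> f (x \<oplus>\<^bsub>M\<^esub> y) = f x \<oplus>\<^bsub>N\<^esub> f y"
    and "\<And>c x. \<lbrakk>c \<in> carrier K; x \<in> carrier M\<rbrakk> \<Longrightarrow> f (c \<odot>\<^bsub>M\<^esub> x) = c \<odot>\<^bsub>N\<^esub> f x"
    and "f \<in> extensional (carrier M)"
  shows "f \<in> linear_maps K M N"
  using assms unfolding linear_maps_def by (auto simp: PiE_def)

lemma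
  assumes "f \<in> linear_maps K M N"
  shows linear_maps_closed: "x \<in> carrier M \<Longrightarrow> f x \<in> carrier N"
    and linear_maps_add:
      "\<lbrakk>x \<in> carrier M; y \<in> carrier M\<rbrakk> \<Longrightarrow> f (x \<oplus>\<^bsub>M\<^esub> y) = f x \<oplus>\<^bsub>N\<^esub> f y"
    and linear_maps_smult:
      "\<lbrakk>c \<in> carrier K; x \<in> carrier M\<rbrakk> \<Longrightarrow> f (c \<odot>\<^bsub>M\<^esub> x) = c \<odot>\<^bsub>N\<^esub> f x"
    and linear_maps_extensional: "f \<in> extensional (carrier M)"
  using assms unfolding linear_maps_def by (auto simp: PiE_def)

lemma linear_maps_zero:
  assumes "module K M" "module K N" "f \<in> linear_maps K M N"
  shows "f \<zero>\<^bsub>M\<^esub> = \<zero>\<^bsub>N\<^esub>"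
proof -
  interpret M: module K M by fact
  interpret N: module K N by fact
  have "f (\<zero>\<^bsub>K\<^esub> \<odot>\<^bsub>M\<^esub> \<zero>\<^bsub>M\<^esub>) = \<zero>\<^bsub>K\<^esub> \<odot>\<^bsub>N\<^esub> f \<zero>\<^bsub>M\<^esub>"
    using linear_maps_smult[OF assms(3)] by blast
  then show ?thesis
    using linear_maps_closed[OF assms(3)] by simp
qed

lemma linear_maps_minus:
  assumes "module K M" "module K N" "f \<in> linear_maps K M N"
    and "x \<in> carrier M" "y \<in> carrier M"
  shows "f (x \<ominus>\<^bsub>M\<^esub> y) = f x \<ominus>\<^bsub>N\<^esub> f y"
proof -
  interpret M: module K M by fact
  interpret N: module K N by fact
  have "x = (x \<ominus>\<^bsub>M\<^esub> y) \<oplus>\<^bsub>M\<^esub> y"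
    using assms(4,5) by (simp add: M.M.minus_eq M.M.a_assoc M.M.l_neg)
  then have "f x = f (x \<ominus>\<^bsub>M\<^esub> y) \<oplus>\<^bsub>N\<^esub> f y"
    using assms by (metis linear_maps_add M.M.minus_closed)
  then show ?thesis
    using linear_maps_closed[OF assms(3)] assms(4,5)
    by (simp add: N.M.minus_eq N.M.a_assoc N.M.r_neg)
qed

text \<open>Serves to bound a span: a linear map that kills a set of generators kills the whole
  submodule spanned by them, because its kernel is one of the submodules in the
  intersection.\<close>

lemma submodule_kernel:
  assumes "module K M" "module K N" "f \<in> linear_maps K M N"
  shows "submodule {x \<in> carrier M. f x = \<zero>\<^bsub>N\<^esub>} K M"
proof -
  interpret M: module K M by fact
  interpret N: module K N by fact
  show ?thesis
  proof (rule M.submoduleI)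
    fix a assume a: "a \<in> {x \<in> carrier M. f x = \<zero>\<^bsub>N\<^esub>}"
    then have "f (\<zero>\<^bsub>M\<^esub> \<ominus>\<^bsub>M\<^esub> a) = \<zero>\<^bsub>N\<^esub> \<ominus>\<^bsub>N\<^esub> \<zero>\<^bsub>N\<^esub>"
      using linear_maps_minus[OF assms] linear_maps_zero[OF assms] by simp
    then show "\<ominus>\<^bsub>M\<^esub> a \<in> {x \<in> carrier M. f x = \<zero>\<^bsub>N\<^esub>}"
      using a by (simp add: M.M.minus_eq N.M.minus_eq)
  qed (use assms in \<open>auto simp: linear_maps_zero linear_maps_add linear_maps_smult\<close>)
qed

section \<open>Free modules\<close>

lemma free_module_carrier_iff:
  "u \<in> carrier (free_module K X) \<longleftrightarrow> (\<forall>p\<in>X. u p \<in> carrier K) \<and>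
     (\<forall>p. p \<notin> X \<longrightarrow> u p = \<zero>\<^bsub>K\<^esub>) \<and> finite {p. u p \<noteq> \<zero>\<^bsub>K\<^esub>}"
  by (auto simp: free_module_def)

lemma free_module_simps [simp]:
  "\<zero>\<^bsub>free_module K X\<^esub> = (\<lambda>p. \<zero>\<^bsub>K\<^esub>)"
  "u \<oplus>\<^bsub>free_module K X\<^esub> v = (\<lambda>p. u p \<oplus>\<^bsub>K\<^esub> v p)"
  "c \<odot>\<^bsub>free_module K X\<^esub> u = (\<lambda>p. c \<otimes>\<^bsub>K\<^esub> u p)"
  by (auto simp: free_module_def)

context cring
begin

lemma free_module_closed: "u \<in> carrier (free_module R X) \<Longrightarrow> u p \<in> carrier R"
  by (cases "p \<in> X") (auto simp: free_module_carrier_iff)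

lemma free_module_closed': "u \<in> carrier (free_module R X) \<Longrightarrow> \<forall>p. u p \<in> carrier R"
  by (intro allI free_module_closed)

lemma free_module_is_module: "module R (free_module R X)"
proof (rule moduleI)
  show "abelian_group (free_module R X)"
  proof (rule abelian_groupI)
    fix u v assume uv: "u \<in> carrier (free_module R X)" "v \<in> carrier (free_module R X)"
    then show "u \<oplus>\<^bsub>free_module R X\<^esub> v \<in> carrier (free_module R X)"
      by (auto simp: free_module_carrier_iff
          intro: finite_subset[of _ "{p. u p \<noteq> \<zero>} \<union> {p. v p \<noteq> \<zero>}"])
    from uv[THEN free_module_closed]
    show "u \<oplus>\<^bsub>free_module R X\<^esub> v = v \<oplus>\<^bsub>free_module R X\<^esub> u"
      by (auto simp: a_comm)
  next
    fix u assume u: "u \<in> carrier (free_module R X)"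
    show "\<exists>v\<in>carrier (free_module R X). v \<oplus>\<^bsub>free_module R X\<^esub> u = \<zero>\<^bsub>free_module R X\<^esub>"
      using u free_module_closed[OF u]
      by (intro bexI[of _ "\<lambda>p. \<ominus> u p"])
        (auto simp: free_module_carrier_iff l_neg intro: finite_subset[of _ "{p. u p \<noteq> \<zero>}"])
  next
    show "\<zero>\<^bsub>free_module R X\<^esub> \<in> carrier (free_module R X)"
      by (simp add: free_module_carrier_iff)
  qed (auto dest!: free_module_closed' simp: fun_eq_iff a_assoc)
next
  fix c u assume "c \<in> carrier R" "u \<in> carrier (free_module R X)"
  then show "c \<odot>\<^bsub>free_module R X\<^esub> u \<in> carrier (free_module R X)"
    by (auto simp: free_module_carrier_iff intro: finite_subset[of _ "{p. u p \<noteq> \<zero>}"])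
qed (auto dest!: free_module_closed' simp: fun_eq_iff l_distr r_distr m_assoc is_cring)

lemma free_gen_closed: "x \<in> X \<Longrightarrow> free_gen R x \<in> carrier (free_module R X)"
  by (auto simp: free_gen_def free_module_carrier_iff)

text \<open>Induction on the finite support: one basis element with its coefficient is split off at
  a time, until the zero function is left.\<close>

lemma free_module_induct [consumes 1, case_names zero add]:
  assumes "u \<in> carrier (free_module R X)"
    and "P (\<lambda>p. \<zero>)"
    and "\<And>c x v. \<lbrakk>c \<in> carrier R; x \<in> X; v \<in> carrier (free_module R X); P v\<rbrakk>
      \<Longrightarrow> P (c \<odot>\<^bsub>free_module R X\<^esub> free_gen R x \<oplus>\<^bsub>free_module R X\<^esub> v)"
  shows "P u"
proof -
  have "finite S \<Longrightarrow> u \<in> carrier (free_module R X) \<Longrightarrow> {p. u p \<noteq> \<zero>} = S \<Longrightarrow> P u" for S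
  proof (induction S arbitrary: u rule: finite_induct)
    case empty
    then have "u = (\<lambda>p. \<zero>)"
      by auto
    then show ?case using assms(2) by simp
  next
    case (insert x S)
    have "x \<in> X" using insert.prems by (auto simp: free_module_carrier_iff)
    have u: "u p \<in> carrier R" for p
      by (rule free_module_closed) fact
    have supp: "{p. (u(x := \<zero>)) p \<noteq> \<zero>} = S"
      using insert by auto
    then have v: "u(x := \<zero>) \<in> carrier (free_module R X)"
      using insert.prems(1) insert.hyps(1) by (auto simp: free_module_carrier_iff)
    \<comment> \<open>The coefficient at \<open>x\<close> is the value \<open>u x\<close>, and
      overwriting \<open>u\<close> by zero at \<open>x\<close> leaves a function with support
      \<open>S\<close>.\<close>
    have eq: "u = u x \<odot>\<^bsub>free_module R X\<^esub> free_gen R x \<oplus>\<^bsub>free_module R X\<^esub> u(x := \<zero>)"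
      using u by (auto simp: free_gen_def)
    then show ?case
      using assms(3)[OF u[of x] \<open>x \<in> X\<close> v insert.IH[OF v supp]] by (simp only: eq[symmetric])
  qed
  then show ?thesis using assms(1) by (auto simp: free_module_carrier_iff)
qed

end

definition free_lift ::
  "('k, 'r) ring_scheme \<Rightarrow> 'x set \<Rightarrow> ('k, 'p, 'q) module_scheme \<Rightarrow> ('x \<Rightarrow> 'p) \<Rightarrow> ('x \<Rightarrow> 'k) \<Rightarrow> 'p"
  where "free_lift K X P f = (\<lambda>u\<in>carrier (free_module K X).
    finsum P (\<lambda>p. u p \<odot>\<^bsub>P\<^esub> f p) {p. u p \<noteq> \<zero>\<^bsub>K\<^esub>})"

context module
begin

text \<open>The sum that defines \<open>free_lift\<close> ranges over the support, which changes
  with \<open>u\<close>. A larger finite index set only adds zero terms, so the sums for two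
  functions and for their sum can be compared over one common set.\<close>

lemma free_lift_eq:
  assumes "f \<in> X \<rightarrow> carrier M" "u \<in> carrier (free_module R X)"
    and "finite S" "S \<subseteq> X" "{p. u p \<noteq> \<zero>\<^bsub>R\<^esub>} \<subseteq> S"
  shows "free_lift R X M f u = finsum M (\<lambda>p. u p \<odot>\<^bsub>M\<^esub> f p) S"
  unfolding free_lift_def restrict_apply'[OF assms(2)]
  using assms funcset_mem[OF assms(1)]
  by (intro M.add.finprod_mono_neutral_cong_left)
    (auto simp: free_module_carrier_iff intro!: smult_l_null smult_closed dest: subsetD[OF assms(4)])

lemma free_lift_linear:
  assumes f: "f \<in> X \<rightarrow> carrier M"
  shows "free_lift R X M f \<in> linear_maps R (free_module R X) M"
proof (rule linear_mapsI)
  interpret F: module R "free_module R X" by (rule R.free_module_is_module)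
  fix u assume u: "u \<in> carrier (free_module R X)"
  then show "free_lift R X M f u \<in> carrier M"
    using f unfolding free_lift_def by
      (auto simp: free_module_carrier_iff intro!: M.finsum_closed smult_closed)
  let ?S = "{p. u p \<noteq> \<zero>\<^bsub>R\<^esub>}"
  have S: "finite ?S" "?S \<subseteq> X" using u by (auto simp: free_module_carrier_iff)
  {
    fix v assume v: "v \<in> carrier (free_module R X)"
    let ?T = "?S \<union> {p. v p \<noteq> \<zero>\<^bsub>R\<^esub>}"
    have T: "finite ?T" "?T \<subseteq> X" using u v by (auto simp: free_module_carrier_iff)
    have uvT: "{p. u p \<oplus>\<^bsub>R\<^esub> v p \<noteq> \<zero>\<^bsub>R\<^esub>} \<subseteq> ?T" by auto
    have uv: "u \<oplus>\<^bsub>free_module R X\<^esub> v \<in> carrier (free_module R X)"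
      using u v by (rule F.M.a_closed)
    have fT: "p \<in> ?T \<Longrightarrow> f p \<in> carrier M" for p using f T(2) by blast
    have "free_lift R X M f (u \<oplus>\<^bsub>free_module R X\<^esub> v) =
        finsum M (\<lambda>p. (u p \<oplus>\<^bsub>R\<^esub> v p) \<odot>\<^bsub>M\<^esub> f p) ?T"
      using free_lift_eq[OF f uv T] uvT by simp
    also have "\<dots> = finsum M (\<lambda>p. u p \<odot>\<^bsub>M\<^esub> f p \<oplus>\<^bsub>M\<^esub> v p \<odot>\<^bsub>M\<^esub> f p) ?T"
      using R.free_module_closed[OF u] R.free_module_closed[OF v] fT
      by (intro M.finsum_cong' refl)
        (auto simp only: Pi_iff intro!: smult_l_distr smult_closed M.a_closed)
    also have "\<dots> = finsum M (\<lambda>p. u p \<odot>\<^bsub>M\<^esub> f p) ?T \<oplus>\<^bsub>M\<^esub> finsum M (\<lambda>p. v p \<odot>\<^bsub>M\<^esub> f p) ?T"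
      using R.free_module_closed[OF u] R.free_module_closed[OF v] fT
      by (intro M.finsum_addf) (auto simp only: Pi_iff intro!: smult_closed)
    also have "\<dots> = free_lift R X M f u \<oplus>\<^bsub>M\<^esub> free_lift R X M f v"
      using free_lift_eq[OF f u T] free_lift_eq[OF f v T] by simp
    finally show "free_lift R X M f (u \<oplus>\<^bsub>free_module R X\<^esub> v) =
        free_lift R X M f u \<oplus>\<^bsub>M\<^esub> free_lift R X M f v" .
  }
  fix c assume c: "c \<in> carrier R"
  have cuS: "{p. c \<otimes>\<^bsub>R\<^esub> u p \<noteq> \<zero>\<^bsub>R\<^esub>} \<subseteq> ?S" using c by auto
  have cu: "c \<odot>\<^bsub>free_module R X\<^esub> u \<in> carrier (free_module R X)"
    using c u by (rule F.smult_closed)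
  have fS: "p \<in> ?S \<Longrightarrow> f p \<in> carrier M" for p using f S(2) by blast
  have "free_lift R X M f (c \<odot>\<^bsub>free_module R X\<^esub> u) =
      finsum M (\<lambda>p. (c \<otimes>\<^bsub>R\<^esub> u p) \<odot>\<^bsub>M\<^esub> f p) ?S"
    using free_lift_eq[OF f cu S] cuS by simp
  also have "\<dots> = finsum M (\<lambda>p. c \<odot>\<^bsub>M\<^esub> (u p \<odot>\<^bsub>M\<^esub> f p)) ?S"
    using R.free_module_closed[OF u] fS c
    by (intro M.finsum_cong' refl) (auto simp only: Pi_iff intro!: smult_assoc1 smult_closed)
  also have "\<dots> = c \<odot>\<^bsub>M\<^esub> finsum M (\<lambda>p. u p \<odot>\<^bsub>M\<^esub> f p) ?S"
    using R.free_module_closed[OF u] fS c S(1)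
    by (intro finsum_smult_ldistr[symmetric]) (auto simp only: Pi_iff intro!: smult_closed)
  also have "\<dots> = c \<odot>\<^bsub>M\<^esub> free_lift R X M f u"
    using free_lift_eq[OF f u S] by simp
  finally show "free_lift R X M f (c \<odot>\<^bsub>free_module R X\<^esub> u) = c \<odot>\<^bsub>M\<^esub> free_lift R X M f u" .
qed (simp add: free_lift_def)

lemma free_lift_gen:
  assumes "f \<in> X \<rightarrow> carrier M" "x \<in> X"
  shows "free_lift R X M f (free_gen R x) = f x"
proof -
  have "f x \<in> carrier M" using assms by auto
  moreover have "{p. free_gen R x p \<noteq> \<zero>\<^bsub>R\<^esub>} \<subseteq> {x}"
    by (auto simp: free_gen_def)
  ultimately show ?thesis
    using free_lift_eq[OF assms(1) R.free_gen_closed[OF assms(2)], of "{x}"] assms(2)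
    by (simp add: free_gen_def)
qed

end

section \<open>Quotient modules\<close>

context module
begin

lemma submodule_span_subset:
  assumes "submodule H R M" "S \<subseteq> H"
  shows "submodule_span R M S \<subseteq> H"
  using assms unfolding submodule_span_def by auto

lemma submodule_span_superset: "S \<subseteq> submodule_span R M S"
  unfolding submodule_span_def by auto

lemma submodule_submodule_span:
  assumes "S \<subseteq> carrier M"
  shows "submodule (submodule_span R M S) R M"
proof (rule submoduleI)
  show "submodule_span R M S \<subseteq> carrier M"
    using submodule_span_subset[OF carrier_is_submodule assms] .
  \<comment> \<open>Zero is obtained from nonemptiness: some element of the submodule is added to
    its own negative.\<close>
  have "\<zero>\<^bsub>M\<^esub> \<in> H" if "submodule H R M" for H
    using submoduleE(2)[OF that] submoduleE(3,5)[OF that] submoduleE(1)[OF that] M.r_neg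
    by (metis equals0I subset_eq)
  then show "\<zero>\<^bsub>M\<^esub> \<in> submodule_span R M S"
    unfolding submodule_span_def by auto
qed (auto simp: submodule_span_def submoduleE)

end

lemma quotient_module_simps [simp]:
  "carrier (quotient_module M H) = a_rcosets\<^bsub>M\<^esub> H"
  "\<zero>\<^bsub>quotient_module M H\<^esub> = H"
  "X \<oplus>\<^bsub>quotient_module M H\<^esub> Y = X <+>\<^bsub>M\<^esub> Y"
  "c \<odot>\<^bsub>quotient_module M H\<^esub> X = H <+>\<^bsub>M\<^esub> (\<lambda>x. c \<odot>\<^bsub>M\<^esub> x) ` X"
  by (auto simp: quotient_module_def)

locale module_quotient = module R M + submodule H R M for R and M (structure) and H
begin

\<comment> \<open>inside this locale, \<open>smult_closed\<close> is the closure of \<open>H\<close>, inherited from \<open>submodule\<close>\<close>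
lemmas scale_closed = module.smult_closed[OF module_axioms]

lemma abelian_subgroup: "abelian_subgroup H M"
  by (intro abelian_subgroupI3 additive_subgroupI subgroup_axioms) unfold_locales

sublocale Q: abelian_subgroup H M
  by (rule abelian_subgroup)

lemma coset_add:
  "\<lbrakk>x \<in> carrier M; y \<in> carrier M\<rbrakk> \<Longrightarrow>
    (H +> x) \<oplus>\<^bsub>quotient_module M H\<^esub> (H +> y) = H +> (x \<oplus> y)"
  by (simp add: Q.a_rcos_sum)

text \<open>Since h + c(k + x) = (h + ck) + cx with h + ck again in \<open>H\<close>, every element
  of the left side lies in the coset of cx. Conversely \<open>x\<close> itself may be taken as the
  representative.\<close>

lemma coset_smult:
  assumes "c \<in> carrier R" "x \<in> carrier M"
  shows "c \<odot>\<^bsub>quotient_module M H\<^esub> (H +> x) = H +> (c \<odot> x)"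
proof -
  have [simp]: "h \<in> H \<Longrightarrow> h \<in> carrier M" for h using Q.a_subset by auto
  have "H <+>\<^bsub>M\<^esub> (\<lambda>x. c \<odot> x) ` (H +> x) = H +> (c \<odot> x)"
  proof (intro equalityI subsetI)
    fix z assume "z \<in> H <+>\<^bsub>M\<^esub> (\<lambda>x. c \<odot> x) ` (H +> x)"
    then obtain h k where hk: "h \<in> H" "k \<in> H" "z = h \<oplus> (c \<odot> (k \<oplus> x))"
      by (auto simp: set_add_def set_mult_def a_r_coset_def r_coset_def)
    then have "z = (h \<oplus> c \<odot> k) \<oplus> c \<odot> x"
      using assms by (simp add: smult_r_distr M.a_assoc)
    moreover have "h \<oplus> c \<odot> k \<in> H"
      using hk assms by simp
    ultimately show "z \<in> H +> (c \<odot> x)"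
      by (auto simp: a_r_coset_def r_coset_def)
  next
    fix z assume "z \<in> H +> (c \<odot> x)"
    then obtain h where h: "h \<in> H" "z = h \<oplus> c \<odot> x"
      by (auto simp: a_r_coset_def r_coset_def)
    moreover have "x \<in> H +> x" using assms Q.a_rcos_self by simp
    ultimately show "z \<in> H <+>\<^bsub>M\<^esub> (\<lambda>x. c \<odot> x) ` (H +> x)"
      by (auto simp: set_add_def set_mult_def)
  qed
  then show ?thesis by simp
qed

lemma coset_closed: "x \<in> carrier M \<Longrightarrow> H +> x \<in> carrier (quotient_module M H)"
  using M.a_rcosetsI[OF Q.a_subset] by simp

lemma cosetE:
  assumes "X \<in> carrier (quotient_module M H)"
  obtains x where "x \<in> carrier M" "X = H +> x"
  using assms by (auto simp: A_RCOSETS_def RCOSETS_def a_r_coset_def)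

lemma coset_zero: "H +> \<zero> = \<zero>\<^bsub>quotient_module M H\<^esub>"
  using Q.a_subset by simp

lemma coset_eqI:
  assumes "x \<in> carrier M" "y \<in> carrier M" "x \<ominus> y \<in> H"
  shows "H +> x = H +> y"
  by (metis assms M.a_coset_add_inv1 M.a_coset_join2 M.minus_closed M.minus_eq Q.a_subgroup Q.a_subset)

lemma coset_eqD:
  assumes "x \<in> carrier M" "y \<in> carrier M" "H +> x = H +> y"
  shows "x \<ominus> y \<in> H"
  by (metis assms M.a_coset_add_inv2 M.a_coset_join1 M.minus_closed M.minus_eq Q.a_subgroup Q.a_subset)

text \<open>Each axiom is checked on representatives: \<open>coset_add\<close> and
  \<open>coset_smult\<close> turn it into the same axiom of \<open>M\<close>.\<close>

lemma quotient_is_module: "module R (quotient_module M H)"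
proof (rule moduleI)
  show "abelian_group (quotient_module M H)"
  proof (rule abelian_groupI)
    fix X assume "X \<in> carrier (quotient_module M H)"
    then obtain x where x: "x \<in> carrier M" "X = H +> x" by (rule cosetE)
    then have "(H +> \<ominus> x) \<oplus>\<^bsub>quotient_module M H\<^esub> X = \<zero>\<^bsub>quotient_module M H\<^esub>"
      by (simp only: coset_add M.a_inv_closed M.l_neg coset_zero)
    then show "\<exists>Y\<in>carrier (quotient_module M H).
        Y \<oplus>\<^bsub>quotient_module M H\<^esub> X = \<zero>\<^bsub>quotient_module M H\<^esub>"
      using x coset_closed M.a_inv_closed by blast
    show "\<zero>\<^bsub>quotient_module M H\<^esub> \<oplus>\<^bsub>quotient_module M H\<^esub> X = X"
      using x by (simp only: coset_zero[symmetric] coset_add M.zero_closed M.l_zero)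
  next
    show "\<zero>\<^bsub>quotient_module M H\<^esub> \<in> carrier (quotient_module M H)"
      using coset_closed[OF M.zero_closed] by (simp only: coset_zero)
  qed (elim cosetE, simp only: coset_add M.a_closed coset_closed M.a_ac)+
qed ((elim cosetE)?, simp only: coset_add coset_smult M.a_closed scale_closed coset_closed
    smult_l_distr smult_r_distr smult_assoc1 smult_one R.is_cring R.a_closed R.m_closed R.one_closed)+

text \<open>\<open>F\<close> evaluates \<phi> at a chosen representative. The choice is harmless
  because two representatives of one coset differ by an element of \<open>H\<close>, where \<phi>
  vanishes.\<close>

lemma quotient_lift:
  assumes "module R P" "\<phi> \<in> linear_maps R M P" "\<And>h. h \<in> H \<Longrightarrow> \<phi> h = \<zero>\<^bsub>P\<^esub>"
  obtains F where "F \<in> linear_maps R (quotient_module M H) P"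
    "\<And>x. x \<in> carrier M \<Longrightarrow> F (H +> x) = \<phi> x"
proof -
  interpret P: module R P by fact
  define F where "F = (\<lambda>X\<in>carrier (quotient_module M H).
    \<phi> (SOME x. x \<in> carrier M \<and> X = H +> x))"
  have F: "F (H +> x) = \<phi> x" if x: "x \<in> carrier M" for x
  proof -
    define y where "y = (SOME y. y \<in> carrier M \<and> H +> x = H +> y)"
    have y: "y \<in> carrier M" "H +> x = H +> y"
      unfolding y_def using someI[of "\<lambda>y. y \<in> carrier M \<and> H +> x = H +> y" x] x by auto
    have "x = (x \<ominus> y) \<oplus> y"
      using x y(1) by (simp add: M.minus_eq M.a_assoc M.l_neg)
    then have "\<phi> x = \<phi> (x \<ominus> y) \<oplus>\<^bsub>P\<^esub> \<phi> y"
      using linear_maps_add[OF assms(2) M.minus_closed[OF x y(1)] y(1)] by simp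
    then have "\<phi> x = \<phi> y"
      using assms(3)[OF coset_eqD[OF x y]] linear_maps_closed[OF assms(2) y(1)] by simp
    then show ?thesis
      unfolding F_def restrict_apply'[OF coset_closed[OF x]] y_def by simp
  qed
  show ?thesis
  proof (rule that)
    show "F \<in> linear_maps R (quotient_module M H) P"
    proof (rule linear_mapsI)
      show "F \<in> extensional (carrier (quotient_module M H))"
        unfolding F_def by (rule restrict_extensional)
    qed (elim cosetE, simp only: coset_add coset_smult F M.a_closed scale_closed
        linear_maps_closed[OF assms(2)] linear_maps_add[OF assms(2)]
        linear_maps_smult[OF assms(2)])+
  qed (rule F)
qed

end

section \<open>Tensor products\<close>

text \<open>The partial maps are restricted because \<open>linear_maps\<close> contains only
  extensional functions; thus nothing is demanded of \<open>f\<close> off the carriers, and plain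
  lambda terms can be bilinear.\<close>

definition bilinear ::
  "('k, 'r) ring_scheme \<Rightarrow> ('k, 'a, 'm) module_scheme \<Rightarrow> ('k, 'b, 'n) module_scheme
    \<Rightarrow> ('k, 'c, 'p) module_scheme \<Rightarrow> ('a \<Rightarrow> 'b \<Rightarrow> 'c) \<Rightarrow> bool"
  where "bilinear K M N P f \<longleftrightarrow>
    (\<forall>x\<in>carrier M. (\<lambda>y\<in>carrier N. f x y) \<in> linear_maps K N P) \<and>
    (\<forall>y\<in>carrier N. (\<lambda>x\<in>carrier M. f x y) \<in> linear_maps K M P)"

lemma restrict_linear_iff:
  assumes "module K M"
  shows "(\<lambda>x\<in>carrier M. f x) \<in> linear_maps K M N \<longleftrightarrow>
    (\<forall>x\<in>carrier M. f x \<in> carrier N) \<and>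
    (\<forall>x\<in>carrier M. \<forall>y\<in>carrier M. f (x \<oplus>\<^bsub>M\<^esub> y) = f x \<oplus>\<^bsub>N\<^esub> f y) \<and>
    (\<forall>c\<in>carrier K. \<forall>x\<in>carrier M. f (c \<odot>\<^bsub>M\<^esub> x) = c \<odot>\<^bsub>N\<^esub> f x)"
proof -
  interpret module K M by fact
  show ?thesis unfolding linear_maps_def by auto
qed

locale module_pair = M: module K M + N: module K N for K and M and N
begin

abbreviation F where "F \<equiv> free_module K (carrier M \<times> carrier N)"
abbreviation ker where "ker \<equiv> tensor_kernel K M N"

sublocale F: module K F
  by (rule M.R.free_module_is_module)

lemma gen_closed: "\<lbrakk>x \<in> carrier M; y \<in> carrier N\<rbrakk> \<Longrightarrow> free_gen K (x, y) \<in> carrier F"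
  by (intro M.R.free_gen_closed) auto

lemma tensor_relations_closed: "tensor_relations K M N \<subseteq> carrier F"
  unfolding tensor_relations_def Let_def
  by (auto simp del: free_module_simps
      intro!: F.M.minus_closed F.M.a_closed F.smult_closed gen_closed)

lemma submodule_tensor_kernel: "submodule ker K F"
  unfolding tensor_kernel_def
  by (rule F.submodule_submodule_span[OF tensor_relations_closed])

sublocale T: module_quotient K F ker
  by (intro module_quotient.intro F.module_axioms submodule_tensor_kernel)

lemma tensor_is_module: "module K (tensor K M N)"
  unfolding tensor_def by (rule T.quotient_is_module)

sublocale tensor: module K "tensor K M N"
  by (rule tensor_is_module)

lemma pure_tensor_closed:
  "\<lbrakk>x \<in> carrier M; y \<in> carrier N\<rbrakk> \<Longrightarrow> pure_tensor K M N x y \<in> carrier (tensor K M N)"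
  unfolding pure_tensor_def tensor_def by (intro T.coset_closed gen_closed)

lemma relation_in_kernel: "u \<in> tensor_relations K M N \<Longrightarrow> u \<in> ker"
  unfolding tensor_kernel_def using F.submodule_span_superset by blast

lemma pure_tensor_add_l:
  assumes "x \<in> carrier M" "x' \<in> carrier M" "y \<in> carrier N"
  shows "pure_tensor K M N (x \<oplus>\<^bsub>M\<^esub> x') y =
    pure_tensor K M N x y \<oplus>\<^bsub>tensor K M N\<^esub> pure_tensor K M N x' y"
proof -
  have "free_gen K (x \<oplus>\<^bsub>M\<^esub> x', y) \<ominus>\<^bsub>F\<^esub> (free_gen K (x, y) \<oplus>\<^bsub>F\<^esub> free_gen K (x', y)) \<in> ker"
    by (rule relation_in_kernel) (use assms in \<open>unfold tensor_relations_def Let_def, blast\<close>)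
  from T.coset_eqI[OF _ _ this] assms show ?thesis
    unfolding pure_tensor_def tensor_def
    by (simp only: T.coset_add gen_closed M.M.a_closed F.M.a_closed)
qed

lemma pure_tensor_add_r:
  assumes "x \<in> carrier M" "y \<in> carrier N" "y' \<in> carrier N"
  shows "pure_tensor K M N x (y \<oplus>\<^bsub>N\<^esub> y') =
    pure_tensor K M N x y \<oplus>\<^bsub>tensor K M N\<^esub> pure_tensor K M N x y'"
proof -
  have "free_gen K (x, y \<oplus>\<^bsub>N\<^esub> y') \<ominus>\<^bsub>F\<^esub> (free_gen K (x, y) \<oplus>\<^bsub>F\<^esub> free_gen K (x, y')) \<in> ker"
    by (rule relation_in_kernel) (use assms in \<open>unfold tensor_relations_def Let_def, blast\<close>)
  from T.coset_eqI[OF _ _ this] assms show ?thesis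
    unfolding pure_tensor_def tensor_def
    by (simp only: T.coset_add gen_closed N.M.a_closed F.M.a_closed)
qed

lemma pure_tensor_smult_l:
  assumes "c \<in> carrier K" "x \<in> carrier M" "y \<in> carrier N"
  shows "pure_tensor K M N (c \<odot>\<^bsub>M\<^esub> x) y = c \<odot>\<^bsub>tensor K M N\<^esub> pure_tensor K M N x y"
proof -
  have "free_gen K (c \<odot>\<^bsub>M\<^esub> x, y) \<ominus>\<^bsub>F\<^esub> c \<odot>\<^bsub>F\<^esub> free_gen K (x, y) \<in> ker"
    by (rule relation_in_kernel) (use assms in \<open>unfold tensor_relations_def Let_def, blast\<close>)
  from T.coset_eqI[OF _ _ this] assms show ?thesis
    unfolding pure_tensor_def tensor_def
    by (simp only: T.coset_smult gen_closed M.smult_closed F.smult_closed)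
qed

lemma pure_tensor_smult_r:
  assumes "c \<in> carrier K" "x \<in> carrier M" "y \<in> carrier N"
  shows "pure_tensor K M N x (c \<odot>\<^bsub>N\<^esub> y) = c \<odot>\<^bsub>tensor K M N\<^esub> pure_tensor K M N x y"
proof -
  have "free_gen K (x, c \<odot>\<^bsub>N\<^esub> y) \<ominus>\<^bsub>F\<^esub> c \<odot>\<^bsub>F\<^esub> free_gen K (x, y) \<in> ker"
    by (rule relation_in_kernel) (use assms in \<open>unfold tensor_relations_def Let_def, blast\<close>)
  from T.coset_eqI[OF _ _ this] assms show ?thesis
    unfolding pure_tensor_def tensor_def
    by (simp only: T.coset_smult gen_closed N.smult_closed F.smult_closed)
qed

section \<open>Bilinear maps and the universal property of the tensor product\<close>

lemma bilinear_iff: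
  "bilinear K M N P f \<longleftrightarrow>
    (\<forall>x\<in>carrier M. \<forall>y\<in>carrier N. f x y \<in> carrier P) \<and>
    (\<forall>x\<in>carrier M. \<forall>x'\<in>carrier M. \<forall>y\<in>carrier N. f (x \<oplus>\<^bsub>M\<^esub> x') y = f x y \<oplus>\<^bsub>P\<^esub> f x' y) \<and>
    (\<forall>x\<in>carrier M. \<forall>y\<in>carrier N. \<forall>y'\<in>carrier N. f x (y \<oplus>\<^bsub>N\<^esub> y') = f x y \<oplus>\<^bsub>P\<^esub> f x y') \<and>
    (\<forall>c\<in>carrier K. \<forall>x\<in>carrier M. \<forall>y\<in>carrier N. f (c \<odot>\<^bsub>M\<^esub> x) y = c \<odot>\<^bsub>P\<^esub> f x y) \<and>
    (\<forall>c\<in>carrier K. \<forall>x\<in>carrier M. \<forall>y\<in>carrier N. f x (c \<odot>\<^bsub>N\<^esub> y) = c \<odot>\<^bsub>P\<^esub> f x y)"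
  unfolding bilinear_def restrict_linear_iff[OF M.module_axioms]
    restrict_linear_iff[OF N.module_axioms] by blast

lemma bilinear_pure_tensor: "bilinear K M N (tensor K M N) (pure_tensor K M N)"
  by (simp add: bilinear_iff pure_tensor_closed pure_tensor_add_l pure_tensor_add_r
      pure_tensor_smult_l pure_tensor_smult_r)

text \<open>Neither a zero case nor a scalar case is required: the zero tensor is the pure tensor of
  two zeros, and a scalar multiple of a pure tensor is pure again, the scalar being absorbed into
  the left factor. So pure tensors generate the tensor product under addition alone.\<close>

lemma tensor_induct [consumes 1, case_names pure add]:
  assumes t: "t \<in> carrier (tensor K M N)"
    and pure: "\<And>x y. \<lbrakk>x \<in> carrier M; y \<in> carrier N\<rbrakk> \<Longrightarrow> P (pure_tensor K M N x y)"
    and add: "\<And>s t. \<lbrakk>s \<in> carrier (tensor K M N); t \<in> carrier (tensor K M N); P s; P t\<rbrakk>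
      \<Longrightarrow> P (s \<oplus>\<^bsub>tensor K M N\<^esub> t)"
  shows "P t"
proof -
  obtain u where u: "u \<in> carrier F" and tu: "t = ker +>\<^bsub>F\<^esub> u"
    using t unfolding tensor_def by (rule T.cosetE)
  have ker_zero: "ker +>\<^bsub>F\<^esub> (\<lambda>p. \<zero>\<^bsub>K\<^esub>) = pure_tensor K M N \<zero>\<^bsub>M\<^esub> \<zero>\<^bsub>N\<^esub>"
  proof -
    have "pure_tensor K M N (\<zero>\<^bsub>K\<^esub> \<odot>\<^bsub>M\<^esub> \<zero>\<^bsub>M\<^esub>) \<zero>\<^bsub>N\<^esub> = \<zero>\<^bsub>tensor K M N\<^esub>"
      by (simp only: pure_tensor_smult_l M.R.zero_closed M.M.zero_closed N.M.zero_closed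
          tensor.smult_l_null pure_tensor_closed)
    then show ?thesis
      using T.coset_zero by (simp add: tensor_def)
  qed
  from u have "P (ker +>\<^bsub>F\<^esub> u)"
  proof (induction rule: M.R.free_module_induct)
    case zero
    then show ?case using ker_zero pure by simp
  next
    case (add c z v)
    from add(2) obtain x y where z: "z = (x, y)" "x \<in> carrier M" "y \<in> carrier N" by auto
    have "ker +>\<^bsub>F\<^esub> (c \<odot>\<^bsub>F\<^esub> free_gen K z \<oplus>\<^bsub>F\<^esub> v) =
        pure_tensor K M N (c \<odot>\<^bsub>M\<^esub> x) y \<oplus>\<^bsub>tensor K M N\<^esub> (ker +>\<^bsub>F\<^esub> v)"
      using add(1,3) z unfolding pure_tensor_smult_l[OF add(1) z(2,3)]
      unfolding pure_tensor_def tensor_def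
      by (simp only: T.coset_smult T.coset_add gen_closed F.smult_closed)
    moreover have "ker +>\<^bsub>F\<^esub> v \<in> carrier (tensor K M N)"
      unfolding tensor_def by (rule T.coset_closed) fact
    ultimately show ?case
      using assms(3)[OF pure_tensor_closed _ assms(2) add(4)] add(1) z by simp
  qed
  then show ?thesis by (simp only: tu)
qed

text \<open>The uniqueness half of the universal property.\<close>

lemma linear_maps_tensor_eqI:
  assumes "G \<in> linear_maps K (tensor K M N) P" "G' \<in> linear_maps K (tensor K M N) P"
    and "\<And>x y. \<lbrakk>x \<in> carrier M; y \<in> carrier N\<rbrakk> \<Longrightarrow>
      G (pure_tensor K M N x y) = G' (pure_tensor K M N x y)"
  shows "G = G'"
proof (rule extensionalityI)
  fix t assume "t \<in> carrier (tensor K M N)"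
  then show "G t = G' t"
    by (induction rule: tensor_induct)
      (simp_all add: assms(3) linear_maps_add[OF assms(1)] linear_maps_add[OF assms(2)])
qed (rule assms(1,2)[THEN linear_maps_extensional])+

text \<open>The existence half: \<open>f\<close> is extended linearly from the basis to the free
  module, bilinearity makes the extension \<phi> vanish on the relations and hence on their span,
  and \<phi> descends to the quotient.\<close>

lemma tensor_lift_exists:
  assumes P: "module K P" and f: "bilinear K M N P f"
  obtains G where "G \<in> linear_maps K (tensor K M N) P"
    and "\<And>x y. \<lbrakk>x \<in> carrier M; y \<in> carrier N\<rbrakk> \<Longrightarrow> G (pure_tensor K M N x y) = f x y"
proof -
  interpret P: module K P by fact
  define \<phi> where "\<phi> = free_lift K (carrier M \<times> carrier N) P (\<lambda>(x, y). f x y)"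
  have fP: "(\<lambda>(x, y). f x y) \<in> carrier M \<times> carrier N \<rightarrow> carrier P"
    using f unfolding bilinear_iff by auto
  have \<phi>: "\<phi> \<in> linear_maps K F P"
    unfolding \<phi>_def by (rule P.free_lift_linear[OF fP])
  have gen: "\<phi> (free_gen K (x, y)) = f x y" if "x \<in> carrier M" "y \<in> carrier N" for x y
    unfolding \<phi>_def using P.free_lift_gen[OF fP] that by auto
  have "\<phi> u = \<zero>\<^bsub>P\<^esub>" if "u \<in> tensor_relations K M N" for u
  proof -
    \<comment> \<open>Every relation has the form v - w, so it suffices that \<phi> agrees on v and
      w. For the four kinds of relations this is exactly the four equational clauses of
      bilinearity.\<close>
    have minus: "\<phi> (v \<ominus>\<^bsub>F\<^esub> w) = \<zero>\<^bsub>P\<^esub>"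
      if "v \<in> carrier F" "w \<in> carrier F" "\<phi> v = \<phi> w" for v w
      using that linear_maps_minus[OF F.module_axioms P \<phi>] linear_maps_closed[OF \<phi>]
      by (simp add: P.M.minus_eq P.M.r_neg)
    show ?thesis
      using \<open>u \<in> tensor_relations K M N\<close> f unfolding tensor_relations_def Let_def bilinear_iff
      by (elim UnE CollectE exE conjE; simp only:; intro minus; simp only: gen_closed gen
          M.M.a_closed N.M.a_closed M.smult_closed N.smult_closed F.M.a_closed F.smult_closed
          linear_maps_add[OF \<phi>] linear_maps_smult[OF \<phi>])
  qed
  then have "ker \<subseteq> {u \<in> carrier F. \<phi> u = \<zero>\<^bsub>P\<^esub>}"
    unfolding tensor_kernel_def
    by (intro F.submodule_span_subset submodule_kernel F.module_axioms P \<phi>)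
      (use tensor_relations_closed in blast)
  then have "\<And>h. h \<in> ker \<Longrightarrow> \<phi> h = \<zero>\<^bsub>P\<^esub>" by blast
  from T.quotient_lift[OF P \<phi> this] obtain G where
    "G \<in> linear_maps K (quotient_module F ker) P" "\<And>u. u \<in> carrier F \<Longrightarrow> G (ker +>\<^bsub>F\<^esub> u) = \<phi> u"
    by blast
  then show ?thesis
    by (intro that[of G]) (simp_all only: tensor_def pure_tensor_def gen_closed gen)
qed

text \<open>Existence and uniqueness give the definite description its meaning; from here on lifts
  are handled by these two facts and not by their definition.\<close>

lemma
  assumes "module K P" "bilinear K M N P f"
  shows tensor_lift_linear: "tensor_lift K M N P f \<in> linear_maps K (tensor K M N) P"
    and tensor_lift_pure: "\<lbrakk>x \<in> carrier M; y \<in> carrier N\<rbrakk> \<Longrightarrow>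
      tensor_lift K M N P f (pure_tensor K M N x y) = f x y"
proof -
  let ?Q = "\<lambda>G. G \<in> linear_maps K (tensor K M N) P \<and>
    (\<forall>x\<in>carrier M. \<forall>y\<in>carrier N. G (pure_tensor K M N x y) = f x y)"
  obtain G where "?Q G"
    using tensor_lift_exists[OF assms] by metis
  then have "\<exists>!G. ?Q G"
    by (intro ex1I) (auto intro: linear_maps_tensor_eqI)
  then have "?Q (tensor_lift K M N P f)"
    unfolding tensor_lift_def by (rule theI')
  then show "tensor_lift K M N P f \<in> linear_maps K (tensor K M N) P"
    and "\<lbrakk>x \<in> carrier M; y \<in> carrier N\<rbrakk> \<Longrightarrow>
      tensor_lift K M N P f (pure_tensor K M N x y) = f x y"
    by auto
qed

lemma tensor_lift_cong:
  assumes "\<And>x y. \<lbrakk>x \<in> carrier M; y \<in> carrier N\<rbrakk> \<Longrightarrow> f x y = g x y"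
  shows "tensor_lift K M N P f = tensor_lift K M N P g"
  unfolding tensor_lift_def using assms by simp

text \<open>A linear map may be moved inside a lift, since both sides are linear in \<open>t\<close>
  and agree on pure tensors. In Sweedler notation this moves a linear map under the summation
  sign.\<close>

lemma linear_tensor_lift:
  assumes "module K P" "module K Q" "bilinear K M N P f" "h \<in> linear_maps K P Q"
    and "t \<in> carrier (tensor K M N)"
  shows "h (tensor_lift K M N P f t) = tensor_lift K M N Q (\<lambda>x y. h (f x y)) t"
proof -
  have hf: "bilinear K M N Q (\<lambda>x y. h (f x y))"
    using assms(3) unfolding bilinear_iff
    by (simp add: linear_maps_closed[OF assms(4)] linear_maps_add[OF assms(4)]
        linear_maps_smult[OF assms(4)])
  note lin = tensor_lift_linear[OF assms(1,3)] tensor_lift_linear[OF assms(2) hf]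
  from assms(5) show ?thesis
    by (induction rule: tensor_induct)
      (simp_all add: tensor_lift_pure[OF assms(1,3)] tensor_lift_pure[OF assms(2) hf]
        lin[THEN linear_maps_add] linear_maps_add[OF assms(4)] lin[THEN linear_maps_closed])
qed

lemma bilinear_add:
  assumes "module K P" "bilinear K M N P f" "bilinear K M N P g"
  shows "bilinear K M N P (\<lambda>x y. f x y \<oplus>\<^bsub>P\<^esub> g x y)"
proof -
  interpret P: module K P by fact
  show ?thesis
    using assms(2,3) unfolding bilinear_iff by (simp add: P.M.a_ac P.smult_r_distr)
qed

lemma tensor_lift_add:
  assumes "module K P" "bilinear K M N P f" "bilinear K M N P g" "t \<in> carrier (tensor K M N)"
  shows "tensor_lift K M N P (\<lambda>x y. f x y \<oplus>\<^bsub>P\<^esub> g x y) t =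
    tensor_lift K M N P f t \<oplus>\<^bsub>P\<^esub> tensor_lift K M N P g t"
proof -
  interpret P: module K P by fact
  note fg = bilinear_add[OF assms(1-3)]
  note lin = tensor_lift_linear[OF assms(1,2)] tensor_lift_linear[OF assms(1,3)]
    tensor_lift_linear[OF assms(1) fg]
  from assms(4) show ?thesis
    by (induction rule: tensor_induct)
      (simp_all add: tensor_lift_pure[OF assms(1,2)] tensor_lift_pure[OF assms(1,3)]
        tensor_lift_pure[OF assms(1) fg] lin[THEN linear_maps_add] lin[THEN linear_maps_closed]
        P.M.a_ac)
qed

lemma bilinear_smult:
  assumes "module K P" "bilinear K M N P f" "c \<in> carrier K"
  shows "bilinear K M N P (\<lambda>x y. c \<odot>\<^bsub>P\<^esub> f x y)"
proof -
  interpret P: module K P by fact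
  show ?thesis
    using assms(2,3) unfolding bilinear_iff
    \<comment> \<open>The scalar \<open>c\<close> has to pass a second scalar in the homogeneity
      clauses, which is where commutativity of the field enters.\<close>
    by (simp add: P.smult_r_distr P.smult_assoc1[symmetric] M.R.m_comm)
qed

lemma tensor_lift_smult:
  assumes "module K P" "bilinear K M N P f" "c \<in> carrier K" "t \<in> carrier (tensor K M N)"
  shows "tensor_lift K M N P (\<lambda>x y. c \<odot>\<^bsub>P\<^esub> f x y) t = c \<odot>\<^bsub>P\<^esub> tensor_lift K M N P f t"
proof -
  interpret P: module K P by fact
  note cf = bilinear_smult[OF assms(1-3)]
  note lin = tensor_lift_linear[OF assms(1,2)] tensor_lift_linear[OF assms(1) cf]
  from assms(4) show ?thesis
    by (induction rule: tensor_induct)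
      (simp_all add: tensor_lift_pure[OF assms(1,2)] tensor_lift_pure[OF assms(1) cf]
        lin[THEN linear_maps_add] lin[THEN linear_maps_closed] P.smult_r_distr assms(3))
qed

section \<open>Substitution into bilinear maps, lifts with a parameter, and tensor products of
  maps\<close>

lemma bilinear_compose:
  assumes "module K P" "module_pair K M' N'" "bilinear K M' N' P f"
    and "\<alpha> \<in> linear_maps K M M'" "\<beta> \<in> linear_maps K N N'"
  shows "bilinear K M N P (\<lambda>x y. f (\<alpha> x) (\<beta> y))"
proof -
  interpret MN': module_pair K M' N' by fact
  show ?thesis
    using assms(3) unfolding bilinear_iff MN'.bilinear_iff
    by (simp add: assms(4,5)[THEN linear_maps_closed] assms(4,5)[THEN linear_maps_add]
        assms(4,5)[THEN linear_maps_smult])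
qed

text \<open>Lifting in two of three variables leaves a map that is bilinear in the tensor and the
  remaining variable \<open>z\<close>, so it can be lifted once more. This is how maps on threefold
  tensor products arise. Linearity in \<open>z\<close> holds because the lift depends linearly on
  the bilinear map, by \<open>tensor_lift_add\<close> and \<open>tensor_lift_smult\<close>.\<close>

lemma bilinear_tensor_lift:
  assumes "module K P" "module K Q"
    and bil: "\<And>z. z \<in> carrier Q \<Longrightarrow> bilinear K M N P (g z)"
    and lin: "\<And>x y. \<lbrakk>x \<in> carrier M; y \<in> carrier N\<rbrakk> \<Longrightarrow>
      (\<lambda>z\<in>carrier Q. g z x y) \<in> linear_maps K Q P"
  shows "bilinear K (tensor K M N) Q P (\<lambda>t z. tensor_lift K M N P (g z) t)"
proof -
  interpret Q: module K Q by fact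
  interpret TQ: module_pair K "tensor K M N" Q by unfold_locales
  note lift = tensor_lift_linear[OF assms(1) bil]
  have add: "tensor_lift K M N P (g (z \<oplus>\<^bsub>Q\<^esub> z')) t =
      tensor_lift K M N P (g z) t \<oplus>\<^bsub>P\<^esub> tensor_lift K M N P (g z') t"
    if "t \<in> carrier (tensor K M N)" "z \<in> carrier Q" "z' \<in> carrier Q" for t z z'
    unfolding tensor_lift_add[OF assms(1) bil bil that(1), OF that(2,3), symmetric]
    by (rule fun_cong[OF tensor_lift_cong])
      (use lin that in \<open>simp add: restrict_linear_iff[OF assms(2)]\<close>)
  have smult: "tensor_lift K M N P (g (c \<odot>\<^bsub>Q\<^esub> z)) t = c \<odot>\<^bsub>P\<^esub> tensor_lift K M N P (g z) t"
    if "t \<in> carrier (tensor K M N)" "z \<in> carrier Q" "c \<in> carrier K" for t z c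
    unfolding tensor_lift_smult[OF assms(1) bil that(3,1), OF that(2), symmetric]
    by (rule fun_cong[OF tensor_lift_cong])
      (use lin that in \<open>simp add: restrict_linear_iff[OF assms(2)]\<close>)
  show ?thesis
    unfolding TQ.bilinear_iff
    by (auto simp: add smult lift[THEN linear_maps_closed] lift[THEN linear_maps_add]
        lift[THEN linear_maps_smult])
qed

text \<open>The second fact eliminates \<open>tensor_map\<close>: under a lift it becomes a
  substitution into the bilinear map. Convolution, coassociativity and the compatibility of \<Delta>
  with products are all brought into Sweedler form this way.\<close>

lemma
  assumes "module_pair K P Q" "f \<in> linear_maps K M P" "g \<in> linear_maps K N Q"
  shows tensor_map_linear: "tensor_map K M N P Q f g \<in> linear_maps K (tensor K M N) (tensor K P Q)"
    and tensor_lift_tensor_map: "\<lbrakk>module K R; bilinear K P Q R h; t \<in> carrier (tensor K M N)\<rbrakk> \<Longrightarrow>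
      tensor_lift K P Q R h (tensor_map K M N P Q f g t) =
      tensor_lift K M N R (\<lambda>x y. h (f x) (g y)) t"
proof -
  interpret PQ: module_pair K P Q by fact
  have bil: "bilinear K M N (tensor K P Q) (\<lambda>x y. pure_tensor K P Q (f x) (g y))"
    by (rule bilinear_compose[OF PQ.tensor_is_module assms(1) PQ.bilinear_pure_tensor assms(2,3)])
  show "tensor_map K M N P Q f g \<in> linear_maps K (tensor K M N) (tensor K P Q)"
    unfolding tensor_map_def by (rule tensor_lift_linear[OF PQ.tensor_is_module bil])
  assume R: "module K R" and h: "bilinear K P Q R h" and t: "t \<in> carrier (tensor K M N)"
  show "tensor_lift K P Q R h (tensor_map K M N P Q f g t) =
      tensor_lift K M N R (\<lambda>x y. h (f x) (g y)) t"
    unfolding tensor_map_def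
      linear_tensor_lift[OF PQ.tensor_is_module R bil PQ.tensor_lift_linear[OF R h] t]
    by (rule fun_cong[OF tensor_lift_cong])
      (simp add: PQ.tensor_lift_pure[OF R h] assms(2,3)[THEN linear_maps_closed])
qed

end

lemma bilinear_flip: "bilinear K M N P f \<Longrightarrow> bilinear K N M P (\<lambda>y x. f x y)"
  unfolding bilinear_def by blast

lemma id_map_linear: "module K M \<Longrightarrow> id_map M \<in> linear_maps K M M"
  unfolding restrict_linear_iff by blast

section \<open>Sweedler calculus\<close>

text \<open>The two conjuncts correspond to the two bracketings: fixing the first variable prepares
  a lift to A \<otimes> (A \<otimes> A), fixing the last one a lift to (A \<otimes> A) \<otimes> A.
  Linearity in each single variable follows from them.\<close>

definition trilinear ::
  "('k, 'r) ring_scheme \<Rightarrow> ('k, 'a, 'm) module_scheme \<Rightarrow> ('a \<Rightarrow> 'a \<Rightarrow> 'a \<Rightarrow> 'a) \<Rightarrow> bool"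
  where "trilinear K A f \<longleftrightarrow>
    (\<forall>x\<in>carrier A. bilinear K A A A (f x)) \<and>
    (\<forall>z\<in>carrier A. bilinear K A A A (\<lambda>x y. f x y z))"

context infinitesimal_bialgebra
begin

text \<open>In Sweedler notation, \<open>sw f a\<close> is \<open>f a\<^sub>1 a\<^sub>2\<close>.\<close>

definition sw :: "('c \<Rightarrow> 'c \<Rightarrow> 'c) \<Rightarrow> 'c \<Rightarrow> 'c"
  where "sw f a = tensor_lift K A A A f (\<Delta> a)"

lemma module_A: "module K A" ..

sublocale AA: module_pair K A A
  by unfold_locales

sublocale A_AA: module_pair K A "tensor K A A"
  by unfold_locales

sublocale AA_A: module_pair K "tensor K A A" A
  by unfold_locales

lemmas comult_closed = linear_maps_closed[OF comult_linear]

lemma sw_closed: "\<lbrakk>bilinear K A A A f; a \<in> carrier A\<rbrakk> \<Longrightarrow> sw f a \<in> carrier A"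
  unfolding sw_def
  by (intro linear_maps_closed[OF AA.tensor_lift_linear] module_A comult_closed)

lemma sw_cong:
  assumes "\<And>x y. \<lbrakk>x \<in> carrier A; y \<in> carrier A\<rbrakk> \<Longrightarrow> f x y = g x y"
  shows "sw f a = sw g a"
  unfolding sw_def by (rule fun_cong[OF AA.tensor_lift_cong[OF assms]])

lemma sw_add:
  assumes "bilinear K A A A f" "bilinear K A A A g" "a \<in> carrier A"
  shows "sw (\<lambda>x y. f x y \<oplus>\<^bsub>A\<^esub> g x y) a = sw f a \<oplus>\<^bsub>A\<^esub> sw g a"
  unfolding sw_def by (intro AA.tensor_lift_add module_A assms comult_closed)

lemma sw_smult:
  assumes "bilinear K A A A f" "c \<in> carrier K" "a \<in> carrier A"
  shows "sw (\<lambda>x y. c \<odot>\<^bsub>A\<^esub> f x y) a = c \<odot>\<^bsub>A\<^esub> sw f a"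
  unfolding sw_def by (intro AA.tensor_lift_smult module_A assms comult_closed)

lemma linear_sw:
  assumes "h \<in> linear_maps K A A" "bilinear K A A A f" "a \<in> carrier A"
  shows "h (sw f a) = sw (\<lambda>x y. h (f x y)) a"
  unfolding sw_def by (intro AA.linear_tensor_lift module_A assms comult_closed)

lemma sw_linear:
  assumes "bilinear K A A A f"
  shows "(\<lambda>a\<in>carrier A. sw f a) \<in> linear_maps K A A"
  using AA.tensor_lift_linear[OF module_A assms]
  unfolding restrict_linear_iff[OF module_A] sw_def
  by (simp add: linear_maps_closed linear_maps_add linear_maps_smult comult_closed
      linear_maps_add[OF comult_linear] linear_maps_smult[OF comult_linear])

lemma trilinear_lift_l:
  assumes "trilinear K A f"
  shows "bilinear K (tensor K A A) A A (\<lambda>t z. tensor_lift K A A A (\<lambda>x y. f x y z) t)"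
  by (rule AA.bilinear_tensor_lift[OF module_A module_A])
    (use assms in \<open>simp_all add: trilinear_def bilinear_def\<close>)

lemma trilinear_lift_r:
  assumes "trilinear K A f"
  shows "bilinear K A (tensor K A A) A (\<lambda>x. tensor_lift K A A A (f x))"
  by (rule bilinear_flip[OF AA.bilinear_tensor_lift[OF module_A module_A]])
    (use assms in \<open>simp_all add: trilinear_def bilinear_def\<close>)

text \<open>The map lifted in two variables is composed with \<Delta> in one slot and the identity
  in the other. This lemma and its mirror image supply the side condition that \<open>sw_add\<close>
  imposes on nested sums.\<close>

lemma bilinear_sw_l:
  assumes "trilinear K A f"
  shows "bilinear K A A A (\<lambda>x y. sw (\<lambda>u v. f u v y) x)"
  using AA.bilinear_compose[OF module_A AA_A.module_pair_axioms trilinear_lift_l[OF assms]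
      comult_linear id_map_linear[OF module_A]]
  unfolding AA.bilinear_iff sw_def by simp

lemma bilinear_sw_r:
  assumes "trilinear K A f"
  shows "bilinear K A A A (\<lambda>x y. sw (f x) y)"
  using AA.bilinear_compose[OF module_A A_AA.module_pair_axioms trilinear_lift_r[OF assms]
      id_map_linear[OF module_A] comult_linear]
  unfolding AA.bilinear_iff sw_def by simp

text \<open>The linear map \<open>?F\<close>, which sends x \<otimes> (y \<otimes> z) to
  \<open>f x y z\<close>, is applied to both sides of the coassociativity equation. One side then
  unfolds at once; on the other \<open>?F\<close> after the canonical reassociation is the lift of
  \<open>f\<close> along the opposite bracketing.\<close>

lemma sw_coassoc:
  assumes f: "trilinear K A f" and a: "a \<in> carrier A"
  shows "sw (\<lambda>x y. sw (\<lambda>u v. f u v y) x) a = sw (\<lambda>x y. sw (f x) y) a"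
proof -
  let ?AA = "tensor K A A"
  let ?F = "tensor_lift K A ?AA A (\<lambda>x. tensor_lift K A A A (f x))"
  \<comment> \<open>The map that \<open>tensor_assoc\<close> lifts: on a pure tensor x \<otimes> y
    in its first argument it yields x \<otimes> (y \<otimes> z).\<close>
  let ?h = "\<lambda>t z. tensor_lift K A A (tensor K A ?AA)
    (\<lambda>x y. pure_tensor K A ?AA x (pure_tensor K A A y z)) t"
  note F = A_AA.tensor_lift_linear[OF module_A trilinear_lift_r[OF f]]
  note id = id_map_linear[OF module_A]
  have pure: "bilinear K A A (tensor K A ?AA) (\<lambda>x y. pure_tensor K A ?AA x (pure_tensor K A A y z))"
    if "z \<in> carrier A" for z
    unfolding AA.bilinear_iff using that
    by (simp add: AA.pure_tensor_closed A_AA.pure_tensor_closed AA.pure_tensor_add_l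
        AA.pure_tensor_smult_l A_AA.pure_tensor_add_l A_AA.pure_tensor_add_r
        A_AA.pure_tensor_smult_l A_AA.pure_tensor_smult_r)
  have h: "bilinear K ?AA A (tensor K A ?AA) ?h"
    by (rule AA.bilinear_tensor_lift[OF A_AA.tensor_is_module module_A pure])
      (simp_all add: restrict_linear_iff[OF module_A] AA.pure_tensor_closed
        A_AA.pure_tensor_closed AA.pure_tensor_add_r AA.pure_tensor_smult_r
        A_AA.pure_tensor_add_r A_AA.pure_tensor_smult_r)
  have Fh: "?F (?h t z) = tensor_lift K A A A (\<lambda>x y. f x y z) t"
    if "t \<in> carrier ?AA" "z \<in> carrier A" for t z
  proof -
    have fx: "x \<in> carrier A \<Longrightarrow> bilinear K A A A (f x)" for x
      using f unfolding trilinear_def by blast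
    show ?thesis
      unfolding AA.linear_tensor_lift[OF A_AA.tensor_is_module module_A pure[OF that(2)] F that(1)]
      by (rule fun_cong[OF AA.tensor_lift_cong])
        (simp add: A_AA.tensor_lift_pure[OF module_A trilinear_lift_r[OF f]]
          AA.pure_tensor_closed AA.tensor_lift_pure[OF module_A fx] that(2))
  qed
  \<comment> \<open>Moving \<open>?F\<close> under the outer lift reduces the claim to
    \<open>Fh\<close>, the same computation one level further in.\<close>
  have Fassoc: "?F (tensor_assoc K A A A s) =
      tensor_lift K ?AA A A (\<lambda>t z. tensor_lift K A A A (\<lambda>x y. f x y z) t) s"
    if "s \<in> carrier (tensor K ?AA A)" for s
    unfolding tensor_assoc_def AA_A.linear_tensor_lift[OF A_AA.tensor_is_module module_A h F that]
    by (rule fun_cong[OF AA_A.tensor_lift_cong]) (rule Fh)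
  have "?F (tensor_assoc K A A A (tensor_map K A A ?AA A \<Delta> (id_map A) (\<Delta> a))) =
      sw (\<lambda>x y. sw (\<lambda>u v. f u v y) x) a"
    unfolding sw_def Fassoc[OF linear_maps_closed[OF AA.tensor_map_linear[OF
          AA_A.module_pair_axioms comult_linear id] comult_closed[OF a]]]
      AA.tensor_lift_tensor_map[OF AA_A.module_pair_axioms comult_linear id module_A
        trilinear_lift_l[OF f] comult_closed[OF a]]
    by (rule fun_cong[OF AA.tensor_lift_cong]) simp
  moreover have "?F (tensor_map K A A A ?AA (id_map A) \<Delta> (\<Delta> a)) = sw (\<lambda>x y. sw (f x) y) a"
    unfolding sw_def AA.tensor_lift_tensor_map[OF A_AA.module_pair_axioms id comult_linear module_A
        trilinear_lift_r[OF f] comult_closed[OF a]]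
    by (rule fun_cong[OF AA.tensor_lift_cong]) simp
  ultimately show ?thesis
    using coassoc[OF a] by simp
qed

section \<open>Multiplication and convolution in Sweedler form\<close>

lemma left_mult_linear: "a \<in> carrier A \<Longrightarrow> (\<lambda>x\<in>carrier A. a \<otimes>\<^bsub>A\<^esub> x) \<in> linear_maps K A A"
  unfolding restrict_linear_iff[OF module_A] by (simp add: mult_closed mult_r_distr smult_mult_r)

lemma right_mult_linear: "b \<in> carrier A \<Longrightarrow> (\<lambda>x\<in>carrier A. x \<otimes>\<^bsub>A\<^esub> b) \<in> linear_maps K A A"
  unfolding restrict_linear_iff[OF module_A] by (simp add: mult_closed mult_l_distr smult_mult_l)

lemma bilinear_mult: "bilinear K A A A (\<lambda>x y. x \<otimes>\<^bsub>A\<^esub> y)"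
  unfolding bilinear_def by (simp add: left_mult_linear right_mult_linear)

lemma sw_left_mult:
  assumes "bilinear K A A A f" "a \<in> carrier A" "c \<in> carrier A"
  shows "c \<otimes>\<^bsub>A\<^esub> sw f a = sw (\<lambda>x y. c \<otimes>\<^bsub>A\<^esub> f x y) a"
proof -
  have "c \<otimes>\<^bsub>A\<^esub> sw f a = sw (\<lambda>x y. (\<lambda>x\<in>carrier A. c \<otimes>\<^bsub>A\<^esub> x) (f x y)) a"
    using linear_sw[OF left_mult_linear[OF assms(3)] assms(1,2)] sw_closed[OF assms(1,2)] by simp
  also have "\<dots> = sw (\<lambda>x y. c \<otimes>\<^bsub>A\<^esub> f x y) a"
    by (rule sw_cong) (use assms(1) in \<open>simp add: AA.bilinear_iff\<close>)
  finally show ?thesis .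
qed

lemma sw_right_mult:
  assumes "bilinear K A A A f" "a \<in> carrier A" "c \<in> carrier A"
  shows "sw f a \<otimes>\<^bsub>A\<^esub> c = sw (\<lambda>x y. f x y \<otimes>\<^bsub>A\<^esub> c) a"
proof -
  have "sw f a \<otimes>\<^bsub>A\<^esub> c = sw (\<lambda>x y. (\<lambda>x\<in>carrier A. x \<otimes>\<^bsub>A\<^esub> c) (f x y)) a"
    using linear_sw[OF right_mult_linear[OF assms(3)] assms(1,2)] sw_closed[OF assms(1,2)] by simp
  also have "\<dots> = sw (\<lambda>x y. f x y \<otimes>\<^bsub>A\<^esub> c) a"
    by (rule sw_cong) (use assms(1) in \<open>simp add: AA.bilinear_iff\<close>)
  finally show ?thesis .
qed

text \<open>The lift of \<open>f\<close> is linear, so it can be applied to each summand of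
  \<open>comult_mult\<close> separately, where the one-sided multiplications become substitutions
  into \<open>f\<close>.\<close>

lemma sw_mult:
  assumes f: "bilinear K A A A f" and a: "a \<in> carrier A" and b: "b \<in> carrier A"
  shows "sw f (a \<otimes>\<^bsub>A\<^esub> b) = sw (\<lambda>x y. f (a \<otimes>\<^bsub>A\<^esub> x) y) b \<oplus>\<^bsub>A\<^esub> sw (\<lambda>x y. f x (y \<otimes>\<^bsub>A\<^esub> b)) a"
proof -
  note id = id_map_linear[OF module_A]
  note AA = AA.module_pair_axioms
  note l = left_mult_linear[OF a] and r = right_mult_linear[OF b]
  have "sw f (a \<otimes>\<^bsub>A\<^esub> b) =
      sw (\<lambda>x y. f ((\<lambda>x\<in>carrier A. a \<otimes>\<^bsub>A\<^esub> x) x) (id_map A y)) b \<oplus>\<^bsub>A\<^esub>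
      sw (\<lambda>x y. f (id_map A x) ((\<lambda>y\<in>carrier A. y \<otimes>\<^bsub>A\<^esub> b) y)) a"
    unfolding sw_def comult_mult[OF a b]
    unfolding AA.tensor_lift_tensor_map[OF AA l id module_A f comult_closed[OF b], symmetric]
      AA.tensor_lift_tensor_map[OF AA id r module_A f comult_closed[OF a], symmetric]
    by (intro linear_maps_add[OF AA.tensor_lift_linear[OF module_A f]]
        linear_maps_closed[OF AA.tensor_map_linear] AA l id r comult_closed a b)
  also have "sw (\<lambda>x y. f ((\<lambda>x\<in>carrier A. a \<otimes>\<^bsub>A\<^esub> x) x) (id_map A y)) b =
      sw (\<lambda>x y. f (a \<otimes>\<^bsub>A\<^esub> x) y) b"
    by (rule sw_cong) simp
  also have "sw (\<lambda>x y. f (id_map A x) ((\<lambda>y\<in>carrier A. y \<otimes>\<^bsub>A\<^esub> b) y)) a =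
      sw (\<lambda>x y. f x (y \<otimes>\<^bsub>A\<^esub> b)) a"
    by (rule sw_cong) simp
  finally show ?thesis .
qed

lemma bilinear_convolution:
  assumes "T \<in> linear_maps K A A" "S \<in> linear_maps K A A"
  shows "bilinear K A A A (\<lambda>x y. T x \<otimes>\<^bsub>A\<^esub> S y)"
  by (rule AA.bilinear_compose[OF module_A AA.module_pair_axioms bilinear_mult assms])

text \<open>\<open>mult_map\<close> is itself a lift, namely that of the product, so the tensor
  product of \<open>T\<close> and \<open>S\<close> turns into a substitution.\<close>

lemma convolution_eq_sw:
  assumes "T \<in> linear_maps K A A" "S \<in> linear_maps K A A" "a \<in> carrier A"
  shows "convolution K A \<Delta> T S a = sw (\<lambda>x y. T x \<otimes>\<^bsub>A\<^esub> S y) a"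
  using AA.tensor_lift_tensor_map[OF AA.module_pair_axioms assms(1,2) module_A bilinear_mult
      comult_closed[OF assms(3)]] assms(3)
  unfolding convolution_def mult_map_def sw_def by simp

lemma convolution_linear:
  assumes "T \<in> linear_maps K A A" "S \<in> linear_maps K A A"
  shows "convolution K A \<Delta> T S \<in> linear_maps K A A"
proof -
  have "convolution K A \<Delta> T S = (\<lambda>a\<in>carrier A. sw (\<lambda>x y. T x \<otimes>\<^bsub>A\<^esub> S y) a)"
    using convolution_eq_sw[OF assms] by (auto simp: convolution_def)
  then show ?thesis
    using sw_linear[OF bilinear_convolution[OF assms]] by simp
qed

end

section \<open>The endomorphism algebra\<close>

lemma End_algebra_simps [simp]:
  "carrier (End_algebra K A) = linear_maps K A A"
  "T \<otimes>\<^bsub>End_algebra K A\<^esub> S = compose (carrier A) T S"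
  "\<zero>\<^bsub>End_algebra K A\<^esub> = (\<lambda>x\<in>carrier A. \<zero>\<^bsub>A\<^esub>)"
  "T \<oplus>\<^bsub>End_algebra K A\<^esub> S = (\<lambda>x\<in>carrier A. T x \<oplus>\<^bsub>A\<^esub> S x)"
  "c \<odot>\<^bsub>End_algebra K A\<^esub> T = (\<lambda>x\<in>carrier A. c \<odot>\<^bsub>A\<^esub> T x)"
  by (simp_all add: End_algebra_def)

lemma linear_maps_eqI:
  assumes "f \<in> linear_maps K M N" "g \<in> linear_maps K M N"
    and "\<And>x. x \<in> carrier M \<Longrightarrow> f x = g x"
  shows "f = g"
  using assms by (intro extensionalityI[of f "carrier M" g] linear_maps_extensional)

context module
begin

lemma compose_linear:
  assumes "T \<in> linear_maps R M M" "S \<in> linear_maps R M M"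
  shows "compose (carrier M) T S \<in> linear_maps R M M"
  unfolding compose_def restrict_linear_iff[OF module_axioms]
  by (simp add: assms[THEN linear_maps_closed] assms[THEN linear_maps_add]
      assms[THEN linear_maps_smult])

lemma add_linear:
  assumes "T \<in> linear_maps R M M" "S \<in> linear_maps R M M"
  shows "(\<lambda>x\<in>carrier M. T x \<oplus>\<^bsub>M\<^esub> S x) \<in> linear_maps R M M"
  unfolding restrict_linear_iff[OF module_axioms]
  by (simp add: assms[THEN linear_maps_closed] assms[THEN linear_maps_add]
      assms[THEN linear_maps_smult] smult_r_distr M.a_ac)

lemma smult_linear:
  assumes "T \<in> linear_maps R M M" "c \<in> carrier R"
  shows "(\<lambda>x\<in>carrier M. c \<odot>\<^bsub>M\<^esub> T x) \<in> linear_maps R M M"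
  unfolding restrict_linear_iff[OF module_axioms]
  by (simp add: assms(1)[THEN linear_maps_closed] assms(1)[THEN linear_maps_add]
      assms(1)[THEN linear_maps_smult] assms(2) smult_r_distr smult_assoc1[symmetric] R.m_comm)

lemma zero_linear: "(\<lambda>x\<in>carrier M. \<zero>\<^bsub>M\<^esub>) \<in> linear_maps R M M"
  unfolding restrict_linear_iff[OF module_axioms] by simp

lemma End_algebra_is_module: "module R (End_algebra R M)"
proof (rule moduleI)
  show "abelian_group (End_algebra R M)"
  proof (rule abelian_groupI)
    fix T assume "T \<in> carrier (End_algebra R M)"
    then have T: "T \<in> linear_maps R M M" by simp
    show "\<exists>S\<in>carrier (End_algebra R M). S \<oplus>\<^bsub>End_algebra R M\<^esub> T = \<zero>\<^bsub>End_algebra R M\<^esub>"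
      \<comment> \<open>The negative of \<open>T\<close> is written as the multiple by -1, so that
        its linearity is an instance of \<open>smult_linear\<close>.\<close>
      by (rule bexI[of _ "\<lambda>x\<in>carrier M. (\<ominus>\<^bsub>R\<^esub> \<one>\<^bsub>R\<^esub>) \<odot>\<^bsub>M\<^esub> T x"])
        (auto simp: smult_linear[OF T] linear_maps_closed[OF T] smult_l_minus M.l_neg)
    show "\<zero>\<^bsub>End_algebra R M\<^esub> \<oplus>\<^bsub>End_algebra R M\<^esub> T = T"
      using add_linear[OF zero_linear T]
      by (intro linear_maps_eqI[OF _ T]) (auto simp: linear_maps_closed[OF T])
  qed (auto simp: add_linear zero_linear linear_maps_closed M.a_ac)
next
  fix T assume "T \<in> carrier (End_algebra R M)"
  then have T: "T \<in> linear_maps R M M" by simp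
  show "\<one>\<^bsub>R\<^esub> \<odot>\<^bsub>End_algebra R M\<^esub> T = T"
    by (rule linear_maps_eqI[OF _ T]) (auto simp: smult_linear[OF T] linear_maps_closed[OF T])
qed (auto simp: smult_linear linear_maps_closed smult_l_distr smult_r_distr smult_assoc1 R.is_cring)

end

lemma End_algebra_associative:
  assumes "field K" "module K A"
  shows "associative_algebra K (End_algebra K A)"
proof -
  interpret field K by fact
  interpret module K A by fact
  interpret E: module K "End_algebra K A" by (rule End_algebra_is_module)
  show ?thesis
  proof unfold_locales
    fix T S U
    assume "T \<in> carrier (End_algebra K A)" "S \<in> carrier (End_algebra K A)"
      "U \<in> carrier (End_algebra K A)"
    then have lin: "T \<in> linear_maps K A A" "S \<in> linear_maps K A A" "U \<in> linear_maps K A A"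
      by simp_all
    note cl = lin[THEN linear_maps_closed] and ad = lin[THEN linear_maps_add]
    show "T \<otimes>\<^bsub>End_algebra K A\<^esub> S \<in> carrier (End_algebra K A)"
      using lin by (simp add: compose_linear)
    show "T \<otimes>\<^bsub>End_algebra K A\<^esub> S \<otimes>\<^bsub>End_algebra K A\<^esub> U =
        T \<otimes>\<^bsub>End_algebra K A\<^esub> (S \<otimes>\<^bsub>End_algebra K A\<^esub> U)"
      using cl by (auto simp: compose_def)
    show "(T \<oplus>\<^bsub>End_algebra K A\<^esub> S) \<otimes>\<^bsub>End_algebra K A\<^esub> U =
        T \<otimes>\<^bsub>End_algebra K A\<^esub> U \<oplus>\<^bsub>End_algebra K A\<^esub> S \<otimes>\<^bsub>End_algebra K A\<^esub> U"
      using cl by (auto simp: compose_def)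
    \<comment> \<open>Here the sum is the inner map, so additivity of the outer map \<open>U\<close>
      is used; the preceding distributive law is a pointwise computation.\<close>
    show "U \<otimes>\<^bsub>End_algebra K A\<^esub> (T \<oplus>\<^bsub>End_algebra K A\<^esub> S) =
        U \<otimes>\<^bsub>End_algebra K A\<^esub> T \<oplus>\<^bsub>End_algebra K A\<^esub> U \<otimes>\<^bsub>End_algebra K A\<^esub> S"
      using cl ad by (auto simp: compose_def)
  next
    fix c T S
    assume "c \<in> carrier K" "T \<in> carrier (End_algebra K A)" "S \<in> carrier (End_algebra K A)"
    then have c: "c \<in> carrier K" and lin: "T \<in> linear_maps K A A" "S \<in> linear_maps K A A"
      by simp_all
    note cl = lin[THEN linear_maps_closed] and sm = lin[THEN linear_maps_smult]
    show "(c \<odot>\<^bsub>End_algebra K A\<^esub> T) \<otimes>\<^bsub>End_algebra K A\<^esub> S =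
        c \<odot>\<^bsub>End_algebra K A\<^esub> (T \<otimes>\<^bsub>End_algebra K A\<^esub> S)"
      using c cl by (auto simp: compose_def)
    show "T \<otimes>\<^bsub>End_algebra K A\<^esub> (c \<odot>\<^bsub>End_algebra K A\<^esub> S) =
        c \<odot>\<^bsub>End_algebra K A\<^esub> (T \<otimes>\<^bsub>End_algebra K A\<^esub> S)"
      using c cl sm by (auto simp: compose_def)
  qed
qed

section \<open>Convolution with the identity\<close>

context infinitesimal_bialgebra
begin

text \<open>This and \<open>conv_id\<close> are the \<beta> and \<gamma> of the theorem. They are
  restricted to the endomorphisms because a Baxter operator must be an extensional linear
  map.\<close>

definition id_conv :: "('c \<Rightarrow> 'c) \<Rightarrow> 'c \<Rightarrow> 'c"
  where "id_conv = (\<lambda>T\<in>carrier (End_algebra K A). convolution K A \<Delta> (id_map A) T)"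

definition conv_id :: "('c \<Rightarrow> 'c) \<Rightarrow> 'c \<Rightarrow> 'c"
  where "conv_id = (\<lambda>T\<in>carrier (End_algebra K A). convolution K A \<Delta> T (id_map A))"

lemmas id_linear = id_map_linear[OF module_A]

lemma id_conv_closed: "T \<in> linear_maps K A A \<Longrightarrow> id_conv T \<in> linear_maps K A A"
  unfolding id_conv_def by (simp add: convolution_linear id_linear)

lemma conv_id_closed: "T \<in> linear_maps K A A \<Longrightarrow> conv_id T \<in> linear_maps K A A"
  unfolding conv_id_def by (simp add: convolution_linear id_linear)

lemma id_conv_eq:
  assumes "T \<in> linear_maps K A A" "a \<in> carrier A"
  shows "id_conv T a = sw (\<lambda>x y. x \<otimes>\<^bsub>A\<^esub> T y) a"
proof -
  have "id_conv T a = sw (\<lambda>x y. id_map A x \<otimes>\<^bsub>A\<^esub> T y) a"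
    unfolding id_conv_def using assms by (simp add: convolution_eq_sw id_linear)
  also have "\<dots> = sw (\<lambda>x y. x \<otimes>\<^bsub>A\<^esub> T y) a"
    by (rule sw_cong) simp
  finally show ?thesis .
qed

lemma conv_id_eq:
  assumes "T \<in> linear_maps K A A" "a \<in> carrier A"
  shows "conv_id T a = sw (\<lambda>x y. T x \<otimes>\<^bsub>A\<^esub> y) a"
proof -
  have "conv_id T a = sw (\<lambda>x y. T x \<otimes>\<^bsub>A\<^esub> id_map A y) a"
    unfolding conv_id_def using assms by (simp add: convolution_eq_sw id_linear)
  also have "\<dots> = sw (\<lambda>x y. T x \<otimes>\<^bsub>A\<^esub> y) a"
    by (rule sw_cong) simp
  finally show ?thesis .
qed

lemma bilinear_mult_l:
  assumes "T \<in> linear_maps K A A"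
  shows "bilinear K A A A (\<lambda>x y. T x \<otimes>\<^bsub>A\<^esub> y)"
  unfolding AA.bilinear_iff
  by (simp add: assms[THEN linear_maps_closed] assms[THEN linear_maps_add]
      assms[THEN linear_maps_smult] mult_closed mult_l_distr mult_r_distr smult_mult_l smult_mult_r)

lemma bilinear_mult_r:
  assumes "T \<in> linear_maps K A A"
  shows "bilinear K A A A (\<lambda>x y. x \<otimes>\<^bsub>A\<^esub> T y)"
  unfolding AA.bilinear_iff
  by (simp add: assms[THEN linear_maps_closed] assms[THEN linear_maps_add]
      assms[THEN linear_maps_smult] mult_closed mult_l_distr mult_r_distr smult_mult_l smult_mult_r)

lemma id_conv_linear: "id_conv \<in> linear_maps K (End_algebra K A) (End_algebra K A)"
proof (rule linear_mapsI)
  fix T S assume "T \<in> carrier (End_algebra K A)" "S \<in> carrier (End_algebra K A)"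
  then have T: "T \<in> linear_maps K A A" and S: "S \<in> linear_maps K A A" by simp_all
  note TS = add_linear[OF T S]
  have "id_conv (\<lambda>x\<in>carrier A. T x \<oplus>\<^bsub>A\<^esub> S x) a = id_conv T a \<oplus>\<^bsub>A\<^esub> id_conv S a"
    if a: "a \<in> carrier A" for a
    unfolding id_conv_eq[OF TS a] id_conv_eq[OF T a] id_conv_eq[OF S a]
      sw_add[OF bilinear_mult_r[OF T] bilinear_mult_r[OF S] a, symmetric]
    by (rule sw_cong) (simp add: mult_r_distr T[THEN linear_maps_closed] S[THEN linear_maps_closed])
  then show "id_conv (T \<oplus>\<^bsub>End_algebra K A\<^esub> S) = id_conv T \<oplus>\<^bsub>End_algebra K A\<^esub> id_conv S"
    by (intro linear_maps_eqI[of _ K A A]) (simp_all add: add_linear T S id_conv_closed)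
next
  fix c T assume "c \<in> carrier K" "T \<in> carrier (End_algebra K A)"
  then have c: "c \<in> carrier K" and T: "T \<in> linear_maps K A A" by simp_all
  note cT = smult_linear[OF T c]
  have "id_conv (\<lambda>x\<in>carrier A. c \<odot>\<^bsub>A\<^esub> T x) a = c \<odot>\<^bsub>A\<^esub> id_conv T a"
    if a: "a \<in> carrier A" for a
    unfolding id_conv_eq[OF cT a] id_conv_eq[OF T a] sw_smult[OF bilinear_mult_r[OF T] c a, symmetric]
    by (rule sw_cong) (simp add: smult_mult_r c T[THEN linear_maps_closed])
  then show "id_conv (c \<odot>\<^bsub>End_algebra K A\<^esub> T) = c \<odot>\<^bsub>End_algebra K A\<^esub> id_conv T"
    by (intro linear_maps_eqI[of _ K A A]) (simp_all add: smult_linear T c id_conv_closed)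
qed (simp_all add: id_conv_closed, simp add: id_conv_def)

lemma conv_id_linear: "conv_id \<in> linear_maps K (End_algebra K A) (End_algebra K A)"
proof (rule linear_mapsI)
  fix T S assume "T \<in> carrier (End_algebra K A)" "S \<in> carrier (End_algebra K A)"
  then have T: "T \<in> linear_maps K A A" and S: "S \<in> linear_maps K A A" by simp_all
  note TS = add_linear[OF T S]
  have "conv_id (\<lambda>x\<in>carrier A. T x \<oplus>\<^bsub>A\<^esub> S x) a = conv_id T a \<oplus>\<^bsub>A\<^esub> conv_id S a"
    if a: "a \<in> carrier A" for a
    unfolding conv_id_eq[OF TS a] conv_id_eq[OF T a] conv_id_eq[OF S a]
      sw_add[OF bilinear_mult_l[OF T] bilinear_mult_l[OF S] a, symmetric]
    by (rule sw_cong) (simp add: mult_l_distr T[THEN linear_maps_closed] S[THEN linear_maps_closed])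
  then show "conv_id (T \<oplus>\<^bsub>End_algebra K A\<^esub> S) = conv_id T \<oplus>\<^bsub>End_algebra K A\<^esub> conv_id S"
    by (intro linear_maps_eqI[of _ K A A]) (simp_all add: add_linear T S conv_id_closed)
next
  fix c T assume "c \<in> carrier K" "T \<in> carrier (End_algebra K A)"
  then have c: "c \<in> carrier K" and T: "T \<in> linear_maps K A A" by simp_all
  note cT = smult_linear[OF T c]
  have "conv_id (\<lambda>x\<in>carrier A. c \<odot>\<^bsub>A\<^esub> T x) a = c \<odot>\<^bsub>A\<^esub> conv_id T a"
    if a: "a \<in> carrier A" for a
    unfolding conv_id_eq[OF cT a] conv_id_eq[OF T a] sw_smult[OF bilinear_mult_l[OF T] c a, symmetric]
    by (rule sw_cong) (simp add: smult_mult_l c T[THEN linear_maps_closed])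
  then show "conv_id (c \<odot>\<^bsub>End_algebra K A\<^esub> T) = c \<odot>\<^bsub>End_algebra K A\<^esub> conv_id T"
    by (intro linear_maps_eqI[of _ K A A]) (simp_all add: smult_linear T c conv_id_closed)
qed (simp_all add: conv_id_closed, simp add: conv_id_def)

text \<open>The identity is evaluated at a point of A, with the argument of the outer operator
  written as one restricted function; \<open>baxter_operator_End\<close> expects this form.\<close>

lemma id_conv_baxter:
  assumes T: "T \<in> linear_maps K A A" and S: "S \<in> linear_maps K A A" and a: "a \<in> carrier A"
  shows "id_conv T (id_conv S a) =
    id_conv (\<lambda>x\<in>carrier A. T (id_conv S x) \<oplus>\<^bsub>A\<^esub> id_conv T (S x)) a"
proof -
  note cl = T[THEN linear_maps_closed] S[THEN linear_maps_closed]
  note bT = id_conv_closed[OF T] and bS = id_conv_closed[OF S]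
  note bcl = bT[THEN linear_maps_closed] bS[THEN linear_maps_closed]
  have lin: "(\<lambda>x\<in>carrier A. T (id_conv S x)) \<in> linear_maps K A A"
    "(\<lambda>x\<in>carrier A. id_conv T (S x)) \<in> linear_maps K A A"
    using compose_linear[OF T bS] compose_linear[OF bT S] by (simp_all add: compose_def)
  have sum: "(\<lambda>x\<in>carrier A. T (id_conv S x) \<oplus>\<^bsub>A\<^esub> id_conv T (S x)) \<in> linear_maps K A A"
    using add_linear[OF lin] by (simp cong: restrict_cong)
  have tri: "trilinear K A (\<lambda>p q v. p \<otimes>\<^bsub>A\<^esub> T (q \<otimes>\<^bsub>A\<^esub> S v))"
    unfolding trilinear_def AA.bilinear_iff
    by (simp add: cl T[THEN linear_maps_add] S[THEN linear_maps_add] T[THEN linear_maps_smult]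
        S[THEN linear_maps_smult] mult_closed mult_l_distr mult_r_distr smult_mult_l smult_mult_r)
  have bil: "bilinear K A A A (\<lambda>u v. u \<otimes>\<^bsub>A\<^esub> id_conv T (S v))"
    using bilinear_mult_r[OF lin(2)] unfolding AA.bilinear_iff by simp
  \<comment> \<open>Here u stands for a_1 and v for a_2. Splitting \<open>S v\<close> leaves
    \<open>u\<close> outside and gives a value of \<open>id_conv T\<close>; splitting
    \<open>u\<close> gives the nested sum that coassociativity has to regroup.\<close>
  have split: "id_conv T (u \<otimes>\<^bsub>A\<^esub> S v) =
      u \<otimes>\<^bsub>A\<^esub> id_conv T (S v) \<oplus>\<^bsub>A\<^esub> sw (\<lambda>p q. p \<otimes>\<^bsub>A\<^esub> T (q \<otimes>\<^bsub>A\<^esub> S v)) u"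
    if u: "u \<in> carrier A" and v: "v \<in> carrier A" for u v
  proof -
    have "id_conv T (u \<otimes>\<^bsub>A\<^esub> S v) = sw (\<lambda>p q. (u \<otimes>\<^bsub>A\<^esub> p) \<otimes>\<^bsub>A\<^esub> T q) (S v) \<oplus>\<^bsub>A\<^esub>
        sw (\<lambda>p q. p \<otimes>\<^bsub>A\<^esub> T (q \<otimes>\<^bsub>A\<^esub> S v)) u"
      using sw_mult[OF bilinear_mult_r[OF T] u cl(2)[OF v]] id_conv_eq[OF T] u v
      by (simp add: mult_closed cl)
    also have "sw (\<lambda>p q. (u \<otimes>\<^bsub>A\<^esub> p) \<otimes>\<^bsub>A\<^esub> T q) (S v) = sw (\<lambda>p q. u \<otimes>\<^bsub>A\<^esub> (p \<otimes>\<^bsub>A\<^esub> T q)) (S v)"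
      by (rule sw_cong) (simp add: mult_assoc u cl)
    also have "\<dots> = u \<otimes>\<^bsub>A\<^esub> id_conv T (S v)"
      using sw_left_mult[OF bilinear_mult_r[OF T] cl(2)[OF v] u] id_conv_eq[OF T cl(2)[OF v]] by simp
    finally show ?thesis .
  qed
  have "id_conv T (id_conv S a) = sw (\<lambda>u v. id_conv T (u \<otimes>\<^bsub>A\<^esub> S v)) a"
    unfolding id_conv_eq[OF S a] by (rule linear_sw[OF bT bilinear_mult_r[OF S] a])
  also have "\<dots> = sw (\<lambda>u v. u \<otimes>\<^bsub>A\<^esub> id_conv T (S v) \<oplus>\<^bsub>A\<^esub>
      sw (\<lambda>p q. p \<otimes>\<^bsub>A\<^esub> T (q \<otimes>\<^bsub>A\<^esub> S v)) u) a"
    by (rule sw_cong) (rule split)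
  also have "\<dots> = sw (\<lambda>u v. u \<otimes>\<^bsub>A\<^esub> id_conv T (S v)) a \<oplus>\<^bsub>A\<^esub>
      sw (\<lambda>u v. sw (\<lambda>p q. p \<otimes>\<^bsub>A\<^esub> T (q \<otimes>\<^bsub>A\<^esub> S v)) u) a"
    by (rule sw_add[OF bil bilinear_sw_l[OF tri] a])
  \<comment> \<open>The inner sum moves from the first component of \<Delta>(a) to the second, which
    brings \<open>q\<close> and \<open>v\<close> together as the two components of a single
    \<open>y\<close>.\<close>
  also have "sw (\<lambda>u v. sw (\<lambda>p q. p \<otimes>\<^bsub>A\<^esub> T (q \<otimes>\<^bsub>A\<^esub> S v)) u) a =
      sw (\<lambda>p y. sw (\<lambda>q v. p \<otimes>\<^bsub>A\<^esub> T (q \<otimes>\<^bsub>A\<^esub> S v)) y) a"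
    by (rule sw_coassoc[OF tri a])
  \<comment> \<open>Left multiplication by \<open>p\<close> and the map \<open>T\<close> are linear
    and leave the inner sum, which is then \<open>id_conv S y\<close>.\<close>
  also have "\<dots> = sw (\<lambda>p y. p \<otimes>\<^bsub>A\<^esub> T (id_conv S y)) a"
  proof (rule sw_cong)
    fix p y assume p: "p \<in> carrier A" and y: "y \<in> carrier A"
    have "bilinear K A A A (\<lambda>q v. T (q \<otimes>\<^bsub>A\<^esub> S v))"
      unfolding AA.bilinear_iff
      by (simp add: cl T[THEN linear_maps_add] S[THEN linear_maps_add] T[THEN linear_maps_smult]
        S[THEN linear_maps_smult] mult_closed mult_l_distr mult_r_distr smult_mult_l smult_mult_r)
    then show "sw (\<lambda>q v. p \<otimes>\<^bsub>A\<^esub> T (q \<otimes>\<^bsub>A\<^esub> S v)) y = p \<otimes>\<^bsub>A\<^esub> T (id_conv S y)"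
      unfolding id_conv_eq[OF S y] linear_sw[OF T bilinear_mult_r[OF S] y]
      by (rule sw_left_mult[OF _ y p, symmetric])
  qed
  also have "sw (\<lambda>u v. u \<otimes>\<^bsub>A\<^esub> id_conv T (S v)) a \<oplus>\<^bsub>A\<^esub> \<dots> =
      sw (\<lambda>u v. u \<otimes>\<^bsub>A\<^esub> id_conv T (S v) \<oplus>\<^bsub>A\<^esub> u \<otimes>\<^bsub>A\<^esub> T (id_conv S v)) a"
    using bilinear_mult_r[OF lin(1)] by (intro sw_add[symmetric] bil a) (simp add: AA.bilinear_iff)
  \<comment> \<open>The factor \<open>u\<close> is taken out. The two summands come in the opposite
    order to that of the claim, hence the appeal to commutativity of addition.\<close>
  also have "\<dots> = id_conv (\<lambda>x\<in>carrier A. T (id_conv S x) \<oplus>\<^bsub>A\<^esub> id_conv T (S x)) a"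
    unfolding id_conv_eq[OF sum a]
    by (rule sw_cong) (simp add: mult_r_distr[symmetric] cl bcl M.a_comm)
  finally show ?thesis .
qed

text \<open>Now the product to be split is \<open>S u\<close> times \<open>v\<close>. The term that
  needs rebracketing comes from splitting \<open>v\<close>, so coassociativity is used from right to
  left.\<close>

lemma conv_id_baxter:
  assumes T: "T \<in> linear_maps K A A" and S: "S \<in> linear_maps K A A" and a: "a \<in> carrier A"
  shows "conv_id T (conv_id S a) =
    conv_id (\<lambda>x\<in>carrier A. T (conv_id S x) \<oplus>\<^bsub>A\<^esub> conv_id T (S x)) a"
proof -
  note cl = T[THEN linear_maps_closed] S[THEN linear_maps_closed]
  note gT = conv_id_closed[OF T] and gS = conv_id_closed[OF S]
  note gcl = gT[THEN linear_maps_closed] gS[THEN linear_maps_closed]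
  have lin: "(\<lambda>x\<in>carrier A. T (conv_id S x)) \<in> linear_maps K A A"
    "(\<lambda>x\<in>carrier A. conv_id T (S x)) \<in> linear_maps K A A"
    using compose_linear[OF T gS] compose_linear[OF gT S] by (simp_all add: compose_def)
  have sum: "(\<lambda>x\<in>carrier A. T (conv_id S x) \<oplus>\<^bsub>A\<^esub> conv_id T (S x)) \<in> linear_maps K A A"
    using add_linear[OF lin] by (simp cong: restrict_cong)
  have tri: "trilinear K A (\<lambda>u p q. T (S u \<otimes>\<^bsub>A\<^esub> p) \<otimes>\<^bsub>A\<^esub> q)"
    unfolding trilinear_def AA.bilinear_iff
    by (simp add: cl T[THEN linear_maps_add] S[THEN linear_maps_add] T[THEN linear_maps_smult]
        S[THEN linear_maps_smult] mult_closed mult_l_distr mult_r_distr smult_mult_l smult_mult_r)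
  have bil: "bilinear K A A A (\<lambda>u v. conv_id T (S u) \<otimes>\<^bsub>A\<^esub> v)"
    using bilinear_mult_l[OF lin(2)] unfolding AA.bilinear_iff by simp
  have split: "conv_id T (S u \<otimes>\<^bsub>A\<^esub> v) =
      sw (\<lambda>p q. T (S u \<otimes>\<^bsub>A\<^esub> p) \<otimes>\<^bsub>A\<^esub> q) v \<oplus>\<^bsub>A\<^esub> conv_id T (S u) \<otimes>\<^bsub>A\<^esub> v"
    if u: "u \<in> carrier A" and v: "v \<in> carrier A" for u v
  proof -
    have "conv_id T (S u \<otimes>\<^bsub>A\<^esub> v) = sw (\<lambda>p q. T (S u \<otimes>\<^bsub>A\<^esub> p) \<otimes>\<^bsub>A\<^esub> q) v \<oplus>\<^bsub>A\<^esub>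
        sw (\<lambda>p q. T p \<otimes>\<^bsub>A\<^esub> (q \<otimes>\<^bsub>A\<^esub> v)) (S u)"
      using sw_mult[OF bilinear_mult_l[OF T] cl(2)[OF u] v] conv_id_eq[OF T] u v
      by (simp add: mult_closed cl)
    also have "sw (\<lambda>p q. T p \<otimes>\<^bsub>A\<^esub> (q \<otimes>\<^bsub>A\<^esub> v)) (S u) = sw (\<lambda>p q. (T p \<otimes>\<^bsub>A\<^esub> q) \<otimes>\<^bsub>A\<^esub> v) (S u)"
      by (rule sw_cong) (simp add: mult_assoc v cl)
    also have "\<dots> = conv_id T (S u) \<otimes>\<^bsub>A\<^esub> v"
      using sw_right_mult[OF bilinear_mult_l[OF T] cl(2)[OF u] v] conv_id_eq[OF T cl(2)[OF u]] by simp
    finally show ?thesis .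
  qed
  have "conv_id T (conv_id S a) = sw (\<lambda>u v. conv_id T (S u \<otimes>\<^bsub>A\<^esub> v)) a"
    unfolding conv_id_eq[OF S a] by (rule linear_sw[OF gT bilinear_mult_l[OF S] a])
  also have "\<dots> = sw (\<lambda>u v. sw (\<lambda>p q. T (S u \<otimes>\<^bsub>A\<^esub> p) \<otimes>\<^bsub>A\<^esub> q) v \<oplus>\<^bsub>A\<^esub>
      conv_id T (S u) \<otimes>\<^bsub>A\<^esub> v) a"
    by (rule sw_cong) (rule split)
  also have "\<dots> = sw (\<lambda>u v. sw (\<lambda>p q. T (S u \<otimes>\<^bsub>A\<^esub> p) \<otimes>\<^bsub>A\<^esub> q) v) a \<oplus>\<^bsub>A\<^esub>
      sw (\<lambda>u v. conv_id T (S u) \<otimes>\<^bsub>A\<^esub> v) a"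
    by (rule sw_add[OF bilinear_sw_r[OF tri] bil a])
  also have "sw (\<lambda>u v. sw (\<lambda>p q. T (S u \<otimes>\<^bsub>A\<^esub> p) \<otimes>\<^bsub>A\<^esub> q) v) a =
      sw (\<lambda>x q. sw (\<lambda>u p. T (S u \<otimes>\<^bsub>A\<^esub> p) \<otimes>\<^bsub>A\<^esub> q) x) a"
    by (rule sw_coassoc[OF tri a, symmetric])
  also have "\<dots> = sw (\<lambda>x q. T (conv_id S x) \<otimes>\<^bsub>A\<^esub> q) a"
  proof (rule sw_cong)
    fix x q assume x: "x \<in> carrier A" and q: "q \<in> carrier A"
    have "bilinear K A A A (\<lambda>u p. T (S u \<otimes>\<^bsub>A\<^esub> p))"
      unfolding AA.bilinear_iff
      by (simp add: cl T[THEN linear_maps_add] S[THEN linear_maps_add] T[THEN linear_maps_smult]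
        S[THEN linear_maps_smult] mult_closed mult_l_distr mult_r_distr smult_mult_l smult_mult_r)
    then show "sw (\<lambda>u p. T (S u \<otimes>\<^bsub>A\<^esub> p) \<otimes>\<^bsub>A\<^esub> q) x = T (conv_id S x) \<otimes>\<^bsub>A\<^esub> q"
      unfolding conv_id_eq[OF S x] linear_sw[OF T bilinear_mult_l[OF S] x]
      by (rule sw_right_mult[OF _ x q, symmetric])
  qed
  also have "\<dots> \<oplus>\<^bsub>A\<^esub> sw (\<lambda>u v. conv_id T (S u) \<otimes>\<^bsub>A\<^esub> v) a =
      sw (\<lambda>u v. T (conv_id S u) \<otimes>\<^bsub>A\<^esub> v \<oplus>\<^bsub>A\<^esub> conv_id T (S u) \<otimes>\<^bsub>A\<^esub> v) a"
    using bilinear_mult_l[OF lin(1)] by (intro sw_add[symmetric] bil a) (simp add: AA.bilinear_iff)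
  also have "\<dots> = conv_id (\<lambda>x\<in>carrier A. T (conv_id S x) \<oplus>\<^bsub>A\<^esub> conv_id T (S x)) a"
    unfolding conv_id_eq[OF sum a]
    by (rule sw_cong) (simp add: mult_l_distr cl gcl)
  finally show ?thesis .
qed

text \<open>Two associativities combine: that of \<Delta> moves the inner sum from the second
  component to the first, and that of the product moves the brackets accordingly.\<close>

lemma id_conv_conv_id:
  assumes T: "T \<in> linear_maps K A A" and a: "a \<in> carrier A"
  shows "id_conv (conv_id T) a = conv_id (id_conv T) a"
proof -
  note cl = T[THEN linear_maps_closed]
  have tri: "trilinear K A (\<lambda>x u v. x \<otimes>\<^bsub>A\<^esub> (T u \<otimes>\<^bsub>A\<^esub> v))"
    unfolding trilinear_def AA.bilinear_iff
    by (simp add: cl T[THEN linear_maps_add] T[THEN linear_maps_smult]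
        mult_closed mult_l_distr mult_r_distr smult_mult_l smult_mult_r)
  have "id_conv (conv_id T) a = sw (\<lambda>x y. sw (\<lambda>u v. x \<otimes>\<^bsub>A\<^esub> (T u \<otimes>\<^bsub>A\<^esub> v)) y) a"
    unfolding id_conv_eq[OF conv_id_closed[OF T] a]
    by (rule sw_cong) (simp add: conv_id_eq[OF T] sw_left_mult[OF bilinear_mult_l[OF T]])
  also have "\<dots> = sw (\<lambda>x y. sw (\<lambda>u v. u \<otimes>\<^bsub>A\<^esub> (T v \<otimes>\<^bsub>A\<^esub> y)) x) a"
    by (rule sw_coassoc[OF tri a, symmetric])
  also have "\<dots> = sw (\<lambda>x y. sw (\<lambda>u v. (u \<otimes>\<^bsub>A\<^esub> T v) \<otimes>\<^bsub>A\<^esub> y) x) a"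
    by (intro sw_cong) (simp add: mult_assoc cl)
  also have "\<dots> = conv_id (id_conv T) a"
    unfolding conv_id_eq[OF id_conv_closed[OF T] a]
    by (rule sw_cong) (simp add: id_conv_eq[OF T] sw_right_mult[OF bilinear_mult_r[OF T]])
  finally show ?thesis .
qed

text \<open>Common to both operators: it passes from an identity between elements of A to the Baxter
  identity between endomorphisms, where products are restricted compositions.\<close>

lemma baxter_operator_End:
  assumes lin: "\<beta> \<in> linear_maps K (End_algebra K A) (End_algebra K A)"
    and baxter: "\<And>T S a. \<lbrakk>T \<in> linear_maps K A A; S \<in> linear_maps K A A; a \<in> carrier A\<rbrakk> \<Longrightarrow>
      \<beta> T (\<beta> S a) = \<beta> (\<lambda>x\<in>carrier A. T (\<beta> S x) \<oplus>\<^bsub>A\<^esub> \<beta> T (S x)) a"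
  shows "baxter_operator K (End_algebra K A) \<beta>"
proof (intro baxter_operator.intro baxter_operator_axioms.intro)
  show "associative_algebra K (End_algebra K A)"
    by (intro End_algebra_associative field_axioms module_A)
  fix T S assume "T \<in> carrier (End_algebra K A)" "S \<in> carrier (End_algebra K A)"
  then have T: "T \<in> linear_maps K A A" and S: "S \<in> linear_maps K A A" by simp_all
  have cl: "\<beta> U \<in> linear_maps K A A" if "U \<in> linear_maps K A A" for U
    using linear_maps_closed[OF lin, of U] that by simp
  have eq: "T \<otimes>\<^bsub>End_algebra K A\<^esub> \<beta> S \<oplus>\<^bsub>End_algebra K A\<^esub> \<beta> T \<otimes>\<^bsub>End_algebra K A\<^esub> S =
      (\<lambda>x\<in>carrier A. T (\<beta> S x) \<oplus>\<^bsub>A\<^esub> \<beta> T (S x))"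
    by (auto simp: compose_def)
  have sum: "(\<lambda>x\<in>carrier A. T (\<beta> S x) \<oplus>\<^bsub>A\<^esub> \<beta> T (S x)) \<in> linear_maps K A A"
    using add_linear[OF compose_linear[OF T cl[OF S]] compose_linear[OF cl[OF T] S]] eq
    by simp
  show "\<beta> T \<otimes>\<^bsub>End_algebra K A\<^esub> \<beta> S =
      \<beta> (T \<otimes>\<^bsub>End_algebra K A\<^esub> \<beta> S \<oplus>\<^bsub>End_algebra K A\<^esub> \<beta> T \<otimes>\<^bsub>End_algebra K A\<^esub> S)"
    unfolding eq
    by (rule linear_maps_eqI[OF _ cl[OF sum]])
      (simp_all add: compose_linear cl T S baxter compose_eq)
qed (rule lin)

end

theorem proposition3p2:
  fixes K :: "('k, 'r) ring_scheme"
    and A :: "('k, 'a, 'm) module_scheme"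
    and \<Delta> :: "'a \<Rightarrow> ('a \<times> 'a \<Rightarrow> 'k) set"
    and \<beta> \<gamma> :: "('a \<Rightarrow> 'a) \<Rightarrow> ('a \<Rightarrow> 'a)"
  assumes "infinitesimal_bialgebra K A \<Delta>"
    and "\<beta> = (\<lambda>T\<in>carrier (End_algebra K A). convolution K A \<Delta> (id_map A) T)"
    and "\<gamma> = (\<lambda>T\<in>carrier (End_algebra K A). convolution K A \<Delta> T (id_map A))"
  shows "baxter_operator K (End_algebra K A) \<beta> \<and>
    baxter_operator K (End_algebra K A) \<gamma> \<and>
    compose (carrier (End_algebra K A)) \<beta> \<gamma> = compose (carrier (End_algebra K A)) \<gamma> \<beta>"
proof -
  interpret infinitesimal_bialgebra K A \<Delta> by fact
  have \<beta>: "\<beta> = id_conv" and \<gamma>: "\<gamma> = conv_id"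
    using assms(2,3) unfolding id_conv_def conv_id_def .
  \<comment> \<open>Both sides are extensional linear maps, so the pointwise identity is an equality
    of functions.\<close>
  have "id_conv (conv_id T) = conv_id (id_conv T)" if "T \<in> linear_maps K A A" for T
    by (rule linear_maps_eqI[of _ K A A])
      (simp_all add: that id_conv_closed conv_id_closed id_conv_conv_id)
  then have "compose (carrier (End_algebra K A)) \<beta> \<gamma> = compose (carrier (End_algebra K A)) \<gamma> \<beta>"
    unfolding compose_def \<beta> \<gamma> by (intro restrict_ext) simp
  then show ?thesis
    unfolding \<beta> \<gamma>
    by (intro conjI baxter_operator_End id_conv_linear conv_id_linear id_conv_baxter conv_id_baxter)
qed

end
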